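(* Let $m\le n$ and $\Omega=[m]\times[n]$. Let $X=\sigma u v^\top+Z\in\mathbb{R}^{m\times n}$, where $\sigma>0$, $\|u\|=\|v\|=1$, and all entries $Z_{i,j}$ are i.i.d. Gaussian with mean $0$ and variance $\eta_0^2$. Let $\delta\in(0,\frac14]$, and assume the initial guess of \texttt{R2RILS} (with rank $r=1$, applied to $X$), a pair of unit vectors $(u_1,v_1)$, satisfies $\alpha_1=u^\top u_1\ge\delta$ and $\beta_1=v^\top v_1\ge\delta$. Denote $\eta=\eta_0\sqrt n$, $R=\sqrt{1-\frac{1}{\sqrt2}}\simeq 0.54$ and $C=\frac{50}{1-R}$. If $$\frac{\eta}{\sigma}\le\frac{\sqrt2}{C}\cdot\delta,$$ then with probability at least $1-e^{-n/2}$, for all $t\ge2$, $$\left\| \begin{pmatrix} u_t \\ v_t \end{pmatrix} - \begin{pmatrix} u \\ v \end{pmatrix} \right\| \leq \sqrt 3\, R^{t-2} + 4C \left(1 - R^{t-2}\right) \frac{\eta}{\sigma}.$$ Hence, after $O(\log(\sigma/\eta))$ iterations, the error $\|(u_t,v_t)-(u,v)\|$ is $O(\eta/\sigma)$ (with absolute constants).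
   Context: $\|\cdot\|$ is the Euclidean norm. The \texttt{R2RILS} algorithm in the rank-1 case with all entries of an $m\times n$ matrix $X$ observed: given unit vectors $(u_t,v_t)\in\mathbb{R}^m\times\mathbb{R}^n$, Step I: let $(\tilde u_t,\tilde v_t)$ be the minimizer of $\|u_t b^\top + a v_t^\top - X\|_F$ over $(a,b)\in\mathbb{R}^m\times\mathbb{R}^n$ having the smallest Euclidean norm $\sqrt{\|a\|^2+\|b\|^2}$ among all minimizers (it is unique). Step II: with $\mathrm{ColNorm}(x)=x/\|x\|$ for a nonzero vector $x$, set $u_{t+1}=\mathrm{ColNorm}(u_t+\mathrm{ColNorm}(\tilde u_t))$ and $v_{t+1}=\mathrm{ColNorm}(v_t+\mathrm{ColNorm}(\tilde v_t))$. The sequence $(u_t,v_t)_{t\ge1}$ is obtained by iterating these two steps from $(u_1,v_1)$. *)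

theory Defs
  imports "HOL-Probability.Probability"
begin

text \<open>An m by n matrix has type \<open>real^'n^'m\<close>. Its \<^const>\<open>norm\<close> is the Euclidean norm of the
  vector of row norms, i.e. the Frobenius norm, and the \<^const>\<open>norm\<close> of a pair \<open>(a, b)\<close> is
  \<open>sqrt ((norm a)\<^sup>2 + (norm b)\<^sup>2)\<close>.\<close>

definition outer_product :: "real^'m \<Rightarrow> real^'n \<Rightarrow> real^'n^'m" where
  "outer_product a b = (\<chi> i j. a $ i * b $ j)"

definition col_norm :: "'a::real_normed_vector \<Rightarrow> 'a" where
  "col_norm x = x /\<^sub>R norm x"

definition lsq_residual ::
  "real^'n^'m \<Rightarrow> (real^'m) \<times> (real^'n) \<Rightarrow> (real^'m) \<times> (real^'n) \<Rightarrow> real" where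
  "lsq_residual X = (\<lambda>(u, v) (a, b). norm (outer_product u b + outer_product a v - X))"

text \<open>The least squares problem always has several minimizers; the one of least norm is
  unique, so the choice made by \<^const>\<open>arg_min\<close> is no choice.\<close>

definition min_norm_lsq :: "real^'n^'m \<Rightarrow> (real^'m) \<times> (real^'n) \<Rightarrow> (real^'m) \<times> (real^'n)" where
  "min_norm_lsq X p = arg_min norm (is_arg_min (lsq_residual X p) (\<lambda>_. True))"

definition r2rils_step :: "real^'n^'m \<Rightarrow> (real^'m) \<times> (real^'n) \<Rightarrow> (real^'m) \<times> (real^'n)" where
  "r2rils_step X = (\<lambda>(u, v). case min_norm_lsq X (u, v) of (u', v') \<Rightarrow>
     (col_norm (u + col_norm u'), col_norm (v + col_norm v')))"

text \<open>All four vectors normalized in a step are nonzero (\<^const>\<open>col_norm\<close> maps \<open>0\<close> to \<open>0\<close>, which is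
  not part of the algorithm).\<close>

definition r2rils_step_ok :: "real^'n^'m \<Rightarrow> (real^'m) \<times> (real^'n) \<Rightarrow> bool" where
  "r2rils_step_ok X = (\<lambda>(u, v). case min_norm_lsq X (u, v) of (u', v') \<Rightarrow>
     u' \<noteq> 0 \<and> v' \<noteq> 0 \<and> u + col_norm u' \<noteq> 0 \<and> v + col_norm v' \<noteq> 0)"

text \<open>Iterates are numbered from \<open>1\<close>: \<open>r2rils X p 1 = p\<close>. The index \<open>0\<close> is never used.\<close>

definition r2rils :: "real^'n^'m \<Rightarrow> (real^'m) \<times> (real^'n) \<Rightarrow> nat \<Rightarrow> (real^'m) \<times> (real^'n)" where
  "r2rils X p t = (r2rils_step X ^^ (t - 1)) p"

end

theory Submission imports Defs begin

text \<open>Put \<open>b = \<sigma> (v \<bullet> v\<^sub>t)\<close>. The least squares solution has first component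
  \<open>b (u - (u \<bullet> u\<^sub>t / 2) u\<^sub>t) + e\<close>, where \<open>norm e\<close> is at most the operator norm of \<open>Z\<close>, and
  symmetrically for the second. Without \<open>e\<close> the new iterate bisects the angle between \<open>u\<^sub>t\<close> and a
  vector on the other side of \<open>u\<close>, and this at least halves the angle to \<open>u\<close>; since the initial
  angle is at most a right angle, the distance to \<open>u\<close> contracts by
  \<open>R = sqrt 2 * sin (pi / 8)\<close>. The perturbation \<open>e\<close> adds an error proportional to
  \<open>norm e / b\<close>; after one step both correlations are at least \<open>1/4\<close>, so from then on this error is a
  fixed multiple of \<open>\<eta> / \<sigma>\<close>. The operator norm of \<open>Z\<close> is at most \<open>11/2 * \<eta>\<close> with the required
  probability, by Markov's inequality for the average of \<open>exp (l x\<^sup>T Z y)\<close> over balls.\<close>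

section \<open>The least squares step\<close>

lemma inner_outer_product: "outer_product a b \<bullet> X = a \<bullet> (X *v b)"
  by (simp add: outer_product_def inner_vec_def matrix_vector_mult_def sum_distrib_left ac_simps)

lemma outer_product_mult_vec: "outer_product a b *v x = (b \<bullet> x) *\<^sub>R a"
  by (simp add: outer_product_def inner_vec_def matrix_vector_mult_def vec_eq_iff sum_distrib_left ac_simps)

lemma vec_mult_outer_product: "x v* outer_product a b = (x \<bullet> a) *\<^sub>R b"
  by (simp add: outer_product_def inner_vec_def vector_matrix_mult_def vec_eq_iff
      sum_distrib_left sum_distrib_right ac_simps)

lemma scaleR_mult_vec: "(c *\<^sub>R A) *v x = c *\<^sub>R (A *v x)" for A :: "real^'n^'m"
  by (simp add: matrix_vector_mult_def vec_eq_iff sum_distrib_left ac_simps)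

lemma vec_mult_scaleR: "x v* (c *\<^sub>R A) = c *\<^sub>R (x v* A)" for A :: "real^'n^'m"
  by (simp add: vector_matrix_mult_def vec_eq_iff sum_distrib_left ac_simps)

lemma vec_mult_add: "x v* (A + B) = x v* A + x v* B" for A :: "real^'n^'m"
  by (simp add: vector_matrix_mult_def vec_eq_iff sum.distrib algebra_simps)

lemma outer_product_add_left: "outer_product (a + a') b = outer_product a b + outer_product a' b"
  and outer_product_add_right: "outer_product a (b + b') = outer_product a b + outer_product a b'"
  by (simp_all add: outer_product_def vec_eq_iff algebra_simps)

text \<open>On unit vectors the minimizers of the least squares problem form a line
  \<open>(X v - c u, X\<^sup>T u - d v)\<close> with \<open>c + d = u\<^sup>T X v\<close>; the shortest one has \<open>c = d\<close>.\<close>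

definition lsq_sol :: "real^'n^'m \<Rightarrow> (real^'m) \<times> (real^'n) \<Rightarrow> (real^'m) \<times> (real^'n)" where
  "lsq_sol X = (\<lambda>(u, v). (X *v v - (u \<bullet> (X *v v) / 2) *\<^sub>R u,
                           u v* X - (u \<bullet> (X *v v) / 2) *\<^sub>R v))"

text \<open>Pythagoras: the residual matrix at \<open>lsq_sol\<close> is annihilated by
  \<open>v\<close> on the right and by \<open>u\<close> on the left. These are the normal equations,
  so it is orthogonal to every \<open>outer_product u b + outer_product a v\<close>.\<close>

lemma lsq_sol_residual:
  fixes X :: "real^'n^'m"
  assumes u: "norm u = 1" and v: "norm v = 1"
  defines "a0 \<equiv> fst (lsq_sol X (u, v))" and "b0 \<equiv> snd (lsq_sol X (u, v))"
  shows "(lsq_residual X (u, v) (a0 + a, b0 + b))\<^sup>2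
    = (lsq_residual X (u, v) (a0, b0))\<^sup>2 + (norm (outer_product u b + outer_product a v))\<^sup>2"
proof -
  define W where "W = outer_product u b0 + outer_product a0 v - X"
  define N where "N = outer_product u b + outer_product a v"
  have uu: "u \<bullet> u = 1" "v \<bullet> v = 1"
    using u v by (simp_all add: norm_eq_1)
  have a0: "a0 = X *v v - (u \<bullet> (X *v v) / 2) *\<^sub>R u"
    and b0: "b0 = u v* X - (u \<bullet> (X *v v) / 2) *\<^sub>R v"
    by (simp_all add: a0_def b0_def lsq_sol_def)
  have "outer_product a v \<bullet> W = 0"
  proof -
    have "W *v v = 0"
      unfolding W_def a0 b0
      by (simp add: matrix_vector_mult_add_rdistrib matrix_vector_mult_diff_rdistrib
          outer_product_mult_vec uu inner_diff_left dot_lmul_matrix scaleR_diff_left[symmetric])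
    then show ?thesis by (simp add: inner_outer_product)
  qed
  moreover have "outer_product u b \<bullet> W = 0"
  proof -
    have "u \<bullet> a0 = u \<bullet> (X *v v) / 2"
      by (simp add: a0 inner_diff_right uu)
    moreover have "b0 \<bullet> b = u \<bullet> (X *v b) - (u \<bullet> (X *v v) / 2) * (v \<bullet> b)"
      by (simp add: b0 inner_diff_left dot_lmul_matrix)
    ultimately show ?thesis
      unfolding W_def
      by (simp add: inner_outer_product matrix_vector_mult_add_rdistrib matrix_vector_mult_diff_rdistrib
          outer_product_mult_vec inner_diff_right inner_add_right uu)
  qed
  ultimately have NW: "N \<bullet> W = 0"
    by (simp add: N_def inner_add_left)
  have "outer_product u (b0 + b) + outer_product (a0 + a) v - X = W + N"
    by (simp add: W_def N_def outer_product_add_left outer_product_add_right)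
  then show ?thesis
    using NW by (simp add: lsq_residual_def W_def[symmetric] N_def[symmetric] power2_norm_eq_inner
        inner_add_left inner_add_right inner_commute)
qed

text \<open>By the Pythagorean identity another minimizer differs by a pair in the kernel of the
  linear map, which is spanned by \<open>(- u, v)\<close>. Since \<open>lsq_sol\<close> is
  orthogonal to that direction, it is the unique shortest minimizer.\<close>

lemma min_norm_lsq_eq:
  assumes u: "norm u = 1" and v: "norm v = 1"
  shows "min_norm_lsq X (u, v) = lsq_sol X (u, v)"
proof -
  obtain a0 b0 where s: "lsq_sol X (u, v) = (a0, b0)" by fastforce
  let ?f = "lsq_residual X (u, v)"
  have uu: "u \<bullet> u = 1" "v \<bullet> v = 1"
    using u v by (simp_all add: norm_eq_1)
  have res: "(?f (a0 + a, b0 + b))\<^sup>2 = (?f (a0, b0))\<^sup>2 + (norm (outer_product u b + outer_product a v))\<^sup>2"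
    for a b using lsq_sol_residual[OF u v, of X a b] by (simp add: s)
  have nonneg: "0 \<le> ?f p" for p
    by (simp add: lsq_residual_def split: prod.split)
  have min0: "is_arg_min ?f (\<lambda>_. True) (a0, b0)"
    unfolding is_arg_min_linorder
  proof safe
    fix a b
    show "?f (a0, b0) \<le> ?f (a, b)"
      using res[of "a - a0" "b - b0"] by (intro power2_le_imp_le[OF _ nonneg]) simp
  qed
  have norm_gt: "norm (a0, b0) < norm p"
    if p: "is_arg_min ?f (\<lambda>_. True) p" "p \<noteq> (a0, b0)" for p
  proof -
    obtain a b where ab: "p = (a0 + a, b0 + b)"
      by (metis add_diff_cancel_left' diff_add_cancel add.commute surj_pair)
    have "?f p \<le> ?f (a0, b0)"
      using p(1) by (simp add: is_arg_min_linorder)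
    then have "(?f p)\<^sup>2 \<le> (?f (a0, b0))\<^sup>2"
      by (intro power_mono nonneg)
    then have N0: "outer_product u b + outer_product a v = 0"
      unfolding ab res by simp
    define c where "c = b \<bullet> v"
    have "(outer_product u b + outer_product a v) *v v = c *\<^sub>R u + a"
      by (simp add: matrix_vector_mult_add_rdistrib outer_product_mult_vec c_def uu)
    then have a: "a = - c *\<^sub>R u"
      using N0 by (simp add: add_eq_0_iff)
    have "u v* (outer_product u b + outer_product a v) = b + (a \<bullet> u) *\<^sub>R v"
      by (simp add: vec_mult_add vec_mult_outer_product uu inner_commute)
    then have "b + (a \<bullet> u) *\<^sub>R v = 0"
      using N0 by (simp add: vector_matrix_mult_def vec_eq_iff)
    then have b: "b = c *\<^sub>R v"
      by (simp add: a uu)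
    have "c \<noteq> 0"
      using p(2) ab a b by auto
    \<comment> \<open>This says that \<open>(a0, b0)\<close> is orthogonal to
      \<open>(- u, v)\<close>, so the cross term vanishes in the squared norm below.\<close>
    have "u \<bullet> a0 = v \<bullet> b0"
    proof -
      have "u \<bullet> a0 = u \<bullet> (X *v v) / 2" "v \<bullet> b0 = u \<bullet> (X *v v) / 2"
        using s by (auto simp: lsq_sol_def inner_diff_right uu inner_commute[of v "u v* X"]
            dot_lmul_matrix)
      then show ?thesis by simp
    qed
    then have "(norm p)\<^sup>2 = (norm (a0, b0))\<^sup>2 + 2 * c\<^sup>2"
      unfolding ab a b power2_norm_eq_inner inner_Pair inner_add_left inner_add_right inner_scaleR_left
        inner_scaleR_right
      by (simp add: inner_commute uu power2_eq_square algebra_simps)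
    then have "(norm (a0, b0))\<^sup>2 < (norm p)\<^sup>2"
      using \<open>c \<noteq> 0\<close> by simp
    then show ?thesis
      by (rule power2_less_imp_less) simp
  qed
  show ?thesis
    unfolding min_norm_lsq_def s arg_min_def
  proof (rule some_equality)
    show "is_arg_min norm (is_arg_min ?f (\<lambda>_. True)) (a0, b0)"
    proof -
      have "\<not> norm y < norm (a0, b0)" if "is_arg_min ?f (\<lambda>_. True) y" for y
        using norm_gt[OF that] by (cases "y = (a0, b0)") auto
      then show ?thesis using min0 unfolding is_arg_min_def[of norm] by blast
    qed
    show "p = (a0, b0)" if "is_arg_min norm (is_arg_min ?f (\<lambda>_. True)) p" for p
      using that min0 norm_gt[of p] unfolding is_arg_min_def[of norm] by blast
  qed
qed

section \<open>Normalization and the half-angle estimate\<close>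

lemma norm_col_norm: "x \<noteq> 0 \<Longrightarrow> norm (col_norm x) = 1"
  by (simp add: col_norm_def)

lemma col_norm_scaleR_pos: "c > 0 \<Longrightarrow> col_norm (c *\<^sub>R x) = col_norm x"
  by (simp add: col_norm_def)

text \<open>After scaling by \<open>norm x\<close> the difference splits into a change of length and
  the vector \<open>y - x\<close>, each at most \<open>norm (y - x)\<close>. For
  \<open>y = 0\<close> the convention \<open>col_norm 0 = 0\<close> reduces the bound to 1 <=
  2.\<close>

lemma norm_col_norm_diff_le:
  assumes "x \<noteq> 0"
  shows "norm (col_norm y - col_norm x) \<le> 2 * norm (y - x) / norm x"
proof (cases "y = 0")
  case True
  then show ?thesis using assms by (simp add: col_norm_def)
next
  case False
  have "norm x *\<^sub>R (col_norm y - col_norm x) = (norm x - norm y) *\<^sub>R col_norm y + (y - x)"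
    using assms False by (simp add: col_norm_def algebra_simps)
  then have "norm x * norm (col_norm y - col_norm x) = norm ((norm x - norm y) *\<^sub>R col_norm y + (y - x))"
    by (metis norm_scaleR abs_norm_cancel)
  also have "\<dots> \<le> \<bar>norm x - norm y\<bar> + norm (y - x)"
    using False by (intro norm_triangle_le) (simp add: norm_col_norm)
  also have "\<dots> \<le> 2 * norm (y - x)"
    using norm_triangle_ineq3[of x y] by (simp add: norm_minus_commute)
  finally show ?thesis
    using assms by (simp add: field_simps)
qed

text \<open>The noise-free step for one factor. The last bound is linear in \<open>c\<close> because
  its difference from 1 is \<open>(1 - 1 / sqrt 2) * (1 - c)\<close>; as unit vectors at correlation
  \<open>c\<close> have squared distance \<open>2 - 2 * c\<close>, this is a contraction of squared
  distances by \<open>1 - 1 / sqrt 2\<close>.\<close>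

lemma col_norm_bisector:
  fixes u p :: "'a::real_inner"
  assumes u: "norm u = 1" and p: "norm p = 1" and c: "0 \<le> u \<bullet> p"
  defines "c \<equiv> u \<bullet> p"
  defines "x \<equiv> u - (c / 2) *\<^sub>R p"
  defines "w \<equiv> p + col_norm x"
  shows "1 / 2 \<le> norm x" and "sqrt 2 \<le> norm w"
    and "1 / sqrt 2 + c * (1 - 1 / sqrt 2) \<le> u \<bullet> col_norm w"
proof -
  have uu: "u \<bullet> u = 1" "p \<bullet> p = 1"
    using u p by (simp_all add: norm_eq_1)
  have c0: "0 \<le> c" using c by (simp add: c_def)
  have c1: "c \<le> 1"
    using norm_cauchy_schwarz[of u p] u p by (simp add: c_def)
  define q where "q = norm x"
  have q2: "q\<^sup>2 = 1 - 3 / 4 * c\<^sup>2"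
    unfolding q_def x_def power2_norm_eq_inner
    by (simp add: inner_diff_left inner_diff_right uu inner_commute[of p u] c_def[symmetric]
        power2_eq_square field_simps)
  have "c\<^sup>2 \<le> c" using c0 c1 by (simp add: power2_eq_square mult_left_le)
  have "(1 - c / 2)\<^sup>2 \<le> q\<^sup>2"
    unfolding q2 using \<open>c\<^sup>2 \<le> c\<close> by (simp add: power2_eq_square field_simps)
  then have qge: "1 - c / 2 \<le> q"
    by (rule power2_le_imp_le) (simp add: q_def)
  then show half: "1 / 2 \<le> norm x" using c1 by (simp add: q_def)
  have q0: "q > 0" using half unfolding q_def by linarith
  have col_x: "z \<bullet> col_norm x = (z \<bullet> x) / q" for z
    using q0 by (simp add: col_norm_def q_def field_simps)
  have pc: "p \<bullet> col_norm x = c / (2 * q)"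
  proof -
    have eq: "p \<bullet> x = c / 2"
      by (simp add: x_def inner_diff_right uu inner_commute[of p u] c_def[symmetric])
    show ?thesis unfolding col_x eq by simp
  qed
  have uc: "u \<bullet> col_norm x = (1 - c\<^sup>2 / 2) / q"
  proof -
    have eq: "u \<bullet> x = 1 - c\<^sup>2 / 2"
      by (simp add: x_def inner_diff_right uu c_def[symmetric] power2_eq_square)
    show ?thesis unfolding col_x eq ..
  qed
  have "x \<noteq> 0" using q0 by (auto simp: q_def)
  then have cc: "col_norm x \<bullet> col_norm x = 1"
    using norm_col_norm[of x] by (simp add: norm_eq_1)
  have w2: "(norm w)\<^sup>2 = 2 + c / q"
    unfolding w_def power2_norm_eq_inner
    by (simp add: inner_add_left inner_add_right uu cc pc inner_commute[of "col_norm x" p])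
  then have "(sqrt 2)\<^sup>2 \<le> (norm w)\<^sup>2" using c0 q0 by simp
  then show wge: "sqrt 2 \<le> norm w"
    by (rule power2_le_imp_le) simp
  then have w0: "norm w > 0"
    by (smt (verit) real_sqrt_gt_zero)
  have uw: "u \<bullet> w = c + (1 - c\<^sup>2 / 2) / q"
    by (simp add: w_def inner_add_right uc c_def[symmetric])
  have ge0: "0 \<le> u \<bullet> w"
    unfolding uw using c0 q0 \<open>c\<^sup>2 \<le> c\<close> c1 by simp
  \<comment> \<open>The new direction bisects the angle between \<open>p\<close> and \<open>x\<close>, which lie on different sides of
    \<open>u\<close>; hence its angle to \<open>u\<close> is at most half of the angle between \<open>u\<close> and \<open>p\<close>.\<close>
  have "(1 + c) / 2 * (norm w)\<^sup>2 \<le> (u \<bullet> w)\<^sup>2"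
  proof -
    \<comment> \<open>Clearing the denominator \<open>q\<close> and eliminating \<open>q * q\<close>
      turns the claim into \<open>c * (1 - c)\<close> times a factor linear in \<open>q\<close>
      being nonnegative. That factor is this product plus 1.\<close>
    have "0 \<le> (q - (1 - c / 2)) * (3 + 2 * c)"
      using qge c0 by simp
    then have "0 \<le> q * (3 + 2 * c) + c\<^sup>2 - c / 2 - 2"
      by (simp add: algebra_simps power2_eq_square)
    then have "0 \<le> c * (1 - c) * (q * (3 + 2 * c) + c\<^sup>2 - c / 2 - 2)"
      using c0 c1 by simp
    also have "\<dots> = 2 * (c * q + 1 - c\<^sup>2 / 2)\<^sup>2 - (1 + c) * (2 * q\<^sup>2 + c * q)"
    proof -
      have qq: "q * q = 1 - 3 / 4 * c\<^sup>2" using q2 by (simp add: power2_eq_square)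
      have "2 * (c * q + 1 - c\<^sup>2 / 2)\<^sup>2 - (1 + c) * (2 * q\<^sup>2 + c * q)
        = 2 * (c\<^sup>2 * (q * q) + 2 * c * q * (1 - c\<^sup>2 / 2) + (1 - c\<^sup>2 / 2)\<^sup>2)
          - (1 + c) * (2 * (q * q) + c * q)"
        by (simp add: power2_eq_square algebra_simps)
      also have "\<dots> = c * (1 - c) * (q * (3 + 2 * c) + c\<^sup>2 - c / 2 - 2)"
        unfolding qq by (simp add: power2_eq_square field_simps)
      finally show ?thesis by simp
    qed
    finally have le: "(1 + c) * (2 * q\<^sup>2 + c * q) \<le> 2 * (c * q + 1 - c\<^sup>2 / 2)\<^sup>2"
      by simp
    have eq: "(1 + c) / 2 * (2 + c / q) * q\<^sup>2 = (1 + c) * (2 * q\<^sup>2 + c * q) / 2"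
      using q0 by (simp add: power2_eq_square field_simps)
    have uwq: "c * q + 1 - c\<^sup>2 / 2 = (u \<bullet> w) * q"
    proof -
      have "(1 - c\<^sup>2 / 2) / q * q = 1 - c\<^sup>2 / 2" using q0 by simp
      then show ?thesis unfolding uw distrib_right by linarith
    qed
    have "(1 + c) / 2 * (2 + c / q) * q\<^sup>2 \<le> ((u \<bullet> w) * q)\<^sup>2"
      using le unfolding uwq eq by linarith
    then have "(1 + c) / 2 * (2 + c / q) * q\<^sup>2 \<le> (u \<bullet> w)\<^sup>2 * q\<^sup>2"
      by (simp only: power_mult_distrib)
    then have "(1 + c) / 2 * (2 + c / q) \<le> (u \<bullet> w)\<^sup>2"
      by (rule mult_right_le_imp_le) (use q0 in simp)
    then show ?thesis
      by (simp only: w2)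
  qed
  moreover have "(sqrt ((1 + c) / 2))\<^sup>2 = (1 + c) / 2"
    using c0 by (intro real_sqrt_pow2) simp
  ultimately have "(sqrt ((1 + c) / 2) * norm w)\<^sup>2 \<le> (u \<bullet> w)\<^sup>2"
    by (simp only: power_mult_distrib)
  then have "sqrt ((1 + c) / 2) * norm w \<le> u \<bullet> w"
    using ge0 by (rule power2_le_imp_le)
  \<comment> \<open>If \<open>c\<close> is the cosine of an angle, the left-hand side is the cosine
    of half that angle.\<close>
  then have half_angle: "sqrt ((1 + c) / 2) \<le> u \<bullet> col_norm w"
    using w0 by (simp add: col_norm_def field_simps)
  \<comment> \<open>The right-hand side is concave in \<open>c\<close>, and the left-hand side is
    its chord between \<open>c = 0\<close> and \<open>c = 1\<close>.\<close>
  have "1 / sqrt 2 + c * (1 - 1 / sqrt 2) \<le> sqrt ((1 + c) / 2)"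
  proof (rule power2_le_imp_le)
    define s where "s = 1 / sqrt 2"
    have s: "s * s = 1 / 2" "0 < s" "s \<le> 1" by (simp_all add: s_def)
    have "(s + c * (1 - s))\<^sup>2 = (1 + c) / 2 - c * (1 - c) * (1 - s)\<^sup>2"
      using s(1) by (simp add: power2_eq_square algebra_simps)
    moreover have "0 \<le> c * (1 - c) * (1 - s)\<^sup>2"
      using c0 c1 by simp
    moreover have "(sqrt ((1 + c) / 2))\<^sup>2 = (1 + c) / 2"
      using c0 by (intro real_sqrt_pow2) simp
    ultimately show "(1 / sqrt 2 + c * (1 - 1 / sqrt 2))\<^sup>2 \<le> (sqrt ((1 + c) / 2))\<^sup>2"
      unfolding s_def by linarith
  qed (use c0 in simp)
  then show "1 / sqrt 2 + c * (1 - 1 / sqrt 2) \<le> u \<bullet> col_norm w"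
    using half_angle by linarith
qed

text \<open>The noise enters only through its size \<epsilon> relative to the signal
  \<open>b\<close>. Each of the two normalizations doubles the error and divides it by a length, at
  least \<open>b / 2\<close> and then \<open>sqrt 2\<close>: the error becomes
  \<open>4 * \<epsilon>\<close> and then \<open>4 * sqrt 2 * \<epsilon>\<close>. For \<epsilon> at
  most 1/8 it cannot cancel the vectors being normalized.\<close>

lemma perturbed_bisector:
  fixes u p e :: "'a::real_inner"
  assumes u: "norm u = 1" and p: "norm p = 1" and c: "0 \<le> u \<bullet> p"
    and b: "0 < b" and e: "norm e \<le> \<epsilon> * b" and eps: "\<epsilon> \<le> 1 / 8"
  defines "y \<equiv> b *\<^sub>R (u - ((u \<bullet> p) / 2) *\<^sub>R p) + e"
  shows "y \<noteq> 0" and "p + col_norm y \<noteq> 0"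
    and "norm (col_norm (p + col_norm y) - u) \<le> sqrt (1 - 1 / sqrt 2) * norm (p - u) + 4 * sqrt 2 * \<epsilon>"
    and "1 / sqrt 2 - 4 * sqrt 2 * \<epsilon> \<le> u \<bullet> col_norm (p + col_norm y)"
proof -
  define x where "x = u - ((u \<bullet> p) / 2) *\<^sub>R p"
  define w where "w = p + col_norm x"
  note bis = col_norm_bisector[OF u p c, folded x_def, folded w_def]
  have eps0: "0 \<le> \<epsilon>"
    using e b by (smt (verit) mult_less_0_iff norm_ge_zero)
  have "norm x \<noteq> 0" using bis(1) by linarith
  then have x0: "norm (b *\<^sub>R x) \<ge> b / 2" "x \<noteq> 0"
    using bis(1) b by (auto simp: field_simps)
  have ye: "y - b *\<^sub>R x = e" by (simp add: y_def x_def)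
  have eb: "\<epsilon> * b \<le> b / 8"
    using mult_right_mono[OF eps, of b] b by simp
  show "y \<noteq> 0"
  proof
    assume "y = 0"
    then have "norm e = norm (b *\<^sub>R x)" using ye by auto
    then show False using e eb x0 b by linarith
  qed
  have "norm (col_norm y - col_norm (b *\<^sub>R x)) \<le> 2 * norm e / norm (b *\<^sub>R x)"
    using norm_col_norm_diff_le[of "b *\<^sub>R x" y] x0 b by (simp add: ye)
  also have "\<dots> \<le> 2 * (\<epsilon> * b) / (b / 2)"
    using e x0 b eps0 by (intro frac_le) auto
  also have "\<dots> = 4 * \<epsilon>" using b by simp
  finally have d1: "norm ((p + col_norm y) - w) \<le> 4 * \<epsilon>"
    by (simp add: w_def col_norm_scaleR_pos[OF b])
  have s2: "1 \<le> sqrt 2" by simp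
  have "4 * \<epsilon> < norm w" using bis(2) eps s2 by linarith
  then show "p + col_norm y \<noteq> 0" using d1 by auto
  have w0: "w \<noteq> 0" using \<open>4 * \<epsilon> < norm w\<close> eps0 by auto
  have "norm (col_norm (p + col_norm y) - col_norm w) \<le> 2 * norm ((p + col_norm y) - w) / norm w"
    by (rule norm_col_norm_diff_le[OF w0])
  also have "\<dots> \<le> 2 * (4 * \<epsilon>) / sqrt 2"
    using d1 bis(2) eps0 by (intro frac_le) auto
  also have "\<dots> = 4 * sqrt 2 * \<epsilon>"
    by (simp add: field_simps)
  finally have d2: "norm (col_norm (p + col_norm y) - col_norm w) \<le> 4 * sqrt 2 * \<epsilon>" .
  have uu: "u \<bullet> u = 1" "p \<bullet> p = 1" "col_norm w \<bullet> col_norm w = 1"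
    using u p norm_col_norm[OF w0] by (simp_all add: norm_eq_1)
  have "norm (col_norm w - u) \<le> sqrt (1 - 1 / sqrt 2) * norm (p - u)"
  proof (rule power2_le_imp_le)
    have "(norm (col_norm w - u))\<^sup>2 = 2 - 2 * (u \<bullet> col_norm w)"
      by (simp add: power2_norm_eq_inner inner_diff_left inner_diff_right uu inner_commute)
    also have "\<dots> \<le> 2 - 2 * (1 / sqrt 2 + u \<bullet> p * (1 - 1 / sqrt 2))"
      by (intro diff_left_mono mult_left_mono bis(3)) simp
    also have "\<dots> = (1 - 1 / sqrt 2) * (2 - 2 * (u \<bullet> p))"
      by (simp only: algebra_simps)
    also have "2 - 2 * (u \<bullet> p) = (norm (p - u))\<^sup>2"
      by (simp add: power2_norm_eq_inner inner_diff_left inner_diff_right uu inner_commute)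
    finally show "(norm (col_norm w - u))\<^sup>2 \<le> (sqrt (1 - 1 / sqrt 2) * norm (p - u))\<^sup>2"
      by (simp add: power_mult_distrib)
  qed simp
  then show "norm (col_norm (p + col_norm y) - u) \<le> sqrt (1 - 1 / sqrt 2) * norm (p - u) + 4 * sqrt 2 * \<epsilon>"
    using d2 norm_triangle_ineq[of "col_norm (p + col_norm y) - col_norm w" "col_norm w - u"] by simp
  have "u \<bullet> (col_norm w - col_norm (p + col_norm y)) \<le> 4 * sqrt 2 * \<epsilon>"
    using norm_cauchy_schwarz[of u "col_norm w - col_norm (p + col_norm y)"] d2 u
    by (simp add: norm_minus_commute)
  moreover have "0 \<le> (u \<bullet> p) * (1 - 1 / sqrt 2)" using c by simp
  ultimately show "1 / sqrt 2 - 4 * sqrt 2 * \<epsilon> \<le> u \<bullet> col_norm (p + col_norm y)"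
    using bis(3) unfolding inner_diff_right by linarith
qed

section \<open>Convergence for a noise matrix of bounded operator norm\<close>

text \<open>The noise part of each component of \<open>lsq_sol\<close> has this form; halving the
  component along a unit vector cannot lengthen it, so the operator norm of the noise bounds
  it.\<close>

lemma norm_minus_half_projection_le:
  fixes p z :: "'a::real_inner"
  assumes "norm p = 1"
  shows "norm (z - (p \<bullet> z / 2) *\<^sub>R p) \<le> norm z"
proof (rule power2_le_imp_le)
  have "p \<bullet> p = 1" using assms by (simp add: norm_eq_1)
  then have "(norm (z - (p \<bullet> z / 2) *\<^sub>R p))\<^sup>2 = (norm z)\<^sup>2 - 3 / 4 * (p \<bullet> z)\<^sup>2"
    unfolding power2_norm_eq_inner inner_diff_left inner_diff_right inner_scaleR_left inner_scaleR_right
    by (simp add: inner_commute power2_eq_square)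
  then show "(norm (z - (p \<bullet> z / 2) *\<^sub>R p))\<^sup>2 \<le> (norm z)\<^sup>2" by simp
qed simp

text \<open>A matrix and its transpose have the same operator norm: the hypothesis is tested on
  \<open>p v* Z\<close> itself.\<close>

lemma norm_vec_mult_le:
  fixes Z :: "real^'n^'m"
  assumes "\<And>z. norm (Z *v z) \<le> K * norm z" and p: "norm p = 1"
  shows "norm (p v* Z) \<le> K"
proof (cases "p v* Z = 0")
  case True
  then show ?thesis
    using order_trans[OF norm_ge_zero assms(1)[of "axis undefined 1"]] by (simp add: norm_axis_1)
next
  case False
  have "norm (p v* Z) * norm (p v* Z) = p \<bullet> (Z *v (p v* Z))"
    by (simp add: dot_lmul_matrix[symmetric] dot_square_norm power2_eq_square)
  also have "\<dots> \<le> norm p * norm (Z *v (p v* Z))"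
    by (rule norm_cauchy_schwarz)
  also have "\<dots> \<le> K * norm (p v* Z)"
    using assms by simp
  finally show ?thesis using False by simp
qed

text \<open>The signal strengths of the two components are \<open>a\<close> and \<open>b\<close>,
  both at least \<open>\<sigma> * \<delta>\<close>, so \<epsilon> bounds the relative noise in both.
  Keeping \<epsilon> and \<delta> as parameters allows one use with the initial correlation and
  another with 1/4.\<close>

lemma r2rils_step_error:
  fixes u p :: "real^'m" and v q :: "real^'n" and Z :: "real^'n^'m"
  assumes u: "norm u = 1" and v: "norm v = 1" and p: "norm p = 1" and q: "norm q = 1"
    and X: "X = \<sigma> *\<^sub>R outer_product u v + Z" and \<sigma>: "0 < \<sigma>"
    and Z: "\<And>z. norm (Z *v z) \<le> K * norm z"
    and \<delta>: "0 < \<delta>" "\<delta> \<le> u \<bullet> p" "\<delta> \<le> v \<bullet> q"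
    and K: "K \<le> \<epsilon> * (\<sigma> * \<delta>)" and \<epsilon>: "0 \<le> \<epsilon>" "\<epsilon> \<le> 1 / 8"
    and step: "r2rils_step X (p, q) = (p', q')"
  shows "r2rils_step_ok X (p, q)" and "norm p' = 1" and "norm q' = 1"
    and "1 / sqrt 2 - 4 * sqrt 2 * \<epsilon> \<le> u \<bullet> p'" and "1 / sqrt 2 - 4 * sqrt 2 * \<epsilon> \<le> v \<bullet> q'"
    and "norm ((p', q') - (u, v)) \<le> sqrt (1 - 1 / sqrt 2) * norm ((p, q) - (u, v)) + 8 * \<epsilon>"
proof -
  define e where "e = Z *v q - (p \<bullet> (Z *v q) / 2) *\<^sub>R p"
  define f where "f = p v* Z - (q \<bullet> (p v* Z) / 2) *\<^sub>R q"
  define a where "a = \<sigma> * (v \<bullet> q)"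
  define b where "b = \<sigma> * (u \<bullet> p)"
  define y where "y = a *\<^sub>R (u - ((u \<bullet> p) / 2) *\<^sub>R p) + e"
  define z where "z = b *\<^sub>R (v - ((v \<bullet> q) / 2) *\<^sub>R q) + f"
  have ab: "0 < a" "0 < b" "\<epsilon> * (\<sigma> * \<delta>) \<le> \<epsilon> * a" "\<epsilon> * (\<sigma> * \<delta>) \<le> \<epsilon> * b"
    using \<sigma> \<delta> \<epsilon> by (auto simp: a_def b_def intro!: mult_left_mono)
  have "norm e \<le> K"
    unfolding e_def using norm_minus_half_projection_le[OF p, of "Z *v q"] Z[of q] q by simp
  then have e: "norm e \<le> \<epsilon> * a" using K ab by linarith
  have "norm f \<le> K"
    unfolding f_def using norm_minus_half_projection_le[OF q, of "p v* Z"] norm_vec_mult_le[OF Z p] by simp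
  then have f: "norm f \<le> \<epsilon> * b" using K ab by linarith
  have Xq: "X *v q = a *\<^sub>R u + Z *v q"
    by (simp add: X a_def matrix_vector_mult_add_rdistrib scaleR_mult_vec outer_product_mult_vec)
  have pX: "p v* X = b *\<^sub>R v + p v* Z"
    by (simp add: X b_def vec_mult_add vec_mult_scaleR vec_mult_outer_product inner_commute)
  have "p \<bullet> (X *v q) = a * (u \<bullet> p) + p \<bullet> (Z *v q)"
    by (simp add: Xq inner_add_right inner_commute)
  \<comment> \<open>The coefficient subtracted in \<open>lsq_sol\<close> is common to both
    components; this symmetry lets it be split as signal plus noise in either one.\<close>
  moreover have "a * (u \<bullet> p) = b * (v \<bullet> q)"
    by (simp add: a_def b_def)
  moreover have "p \<bullet> (Z *v q) = q \<bullet> (p v* Z)"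
    by (simp add: dot_lmul_matrix[symmetric] inner_commute)
  ultimately have sol: "lsq_sol X (p, q) = (y, z)"
    by (simp add: lsq_sol_def Xq pX y_def z_def e_def f_def algebra_simps add_divide_distrib)
  have uv: "0 \<le> u \<bullet> p" "0 \<le> v \<bullet> q" using \<delta> by auto
  note py = perturbed_bisector[OF u p uv(1) ab(1) e \<epsilon>(2), folded y_def]
  note qz = perturbed_bisector[OF v q uv(2) ab(2) f \<epsilon>(2), folded z_def]
  have p': "p' = col_norm (p + col_norm y)" and q': "q' = col_norm (q + col_norm z)"
    using step by (simp_all add: r2rils_step_def min_norm_lsq_eq[OF p q] sol)
  show "r2rils_step_ok X (p, q)"
    using py qz by (simp add: r2rils_step_ok_def min_norm_lsq_eq[OF p q] sol)
  show "norm p' = 1" "norm q' = 1"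
    using py qz by (simp_all add: p' q' norm_col_norm)
  show "1 / sqrt 2 - 4 * sqrt 2 * \<epsilon> \<le> u \<bullet> p'" "1 / sqrt 2 - 4 * sqrt 2 * \<epsilon> \<le> v \<bullet> q'"
    using py qz by (simp_all add: p' q')
  define R where "R = sqrt (1 - 1 / sqrt 2)"
  define \<tau> where "\<tau> = 4 * sqrt 2 * \<epsilon>"
  have R: "0 \<le> R" by (simp add: R_def)
  have \<tau>: "0 \<le> \<tau>" using \<epsilon> by (simp add: \<tau>_def)
  have "norm ((p', q') - (u, v)) = sqrt ((norm (p' - u))\<^sup>2 + (norm (q' - v))\<^sup>2)"
    by (simp add: norm_Pair)
  also have "\<dots> \<le> sqrt ((R * norm (p - u) + \<tau>)\<^sup>2 + (R * norm (q - v) + \<tau>)\<^sup>2)"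
    using py(3) qz(3) by (intro real_sqrt_le_mono add_mono power_mono) (simp_all add: p' q' R_def \<tau>_def)
  \<comment> \<open>Minkowski in the plane separates the contracted distance from the noise; the two
    errors \<tau> combine to \<open>sqrt 2 * \<tau>\<close>, which is
    \<open>8 * \<epsilon>\<close>.\<close>
  also have "\<dots> \<le> sqrt ((R * norm (p - u))\<^sup>2 + (R * norm (q - v))\<^sup>2) + sqrt (\<tau>\<^sup>2 + \<tau>\<^sup>2)"
    by (rule real_sqrt_sum_squares_triangle_ineq)
  also have "sqrt ((R * norm (p - u))\<^sup>2 + (R * norm (q - v))\<^sup>2) = R * norm ((p, q) - (u, v))"
    using R by (simp add: norm_Pair power_mult_distrib distrib_left[symmetric] real_sqrt_mult)
  also have "sqrt (\<tau>\<^sup>2 + \<tau>\<^sup>2) = 8 * \<epsilon>"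
  proof -
    have "\<tau>\<^sup>2 + \<tau>\<^sup>2 = (8 * \<epsilon>)\<^sup>2" by (simp add: \<tau>_def power_mult_distrib)
    then show ?thesis using \<epsilon>(1) by (simp only: real_sqrt_abs)
  qed
  finally show "norm ((p', q') - (u, v)) \<le> sqrt (1 - 1 / sqrt 2) * norm ((p, q) - (u, v)) + 8 * \<epsilon>"
    by (simp add: R_def)
qed

section \<open>Numerical values of the rate and iteration of the step bound\<close>

lemma rate_bounds:
  defines "R \<equiv> sqrt (1 - 1 / sqrt 2)"
  shows "1 / 2 \<le> R" and "R \<le> 59 / 100" and "7 / 10 \<le> 1 / sqrt 2" and "R\<^sup>2 = 1 - 1 / sqrt 2"
proof -
  have s: "1 / sqrt 2 = sqrt 2 / 2" by (simp add: real_div_sqrt field_simps)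
  have "sqrt 2 \<le> 142 / 100" by (rule real_le_lsqrt) (simp_all add: power2_eq_square)
  moreover have "14 / 10 \<le> sqrt 2" by (rule real_le_rsqrt) (simp add: power2_eq_square)
  ultimately have b: "7 / 10 \<le> 1 / sqrt 2" "1 / sqrt 2 \<le> 71 / 100" unfolding s by simp_all
  then show "7 / 10 \<le> 1 / sqrt 2" by simp
  show "1 / 2 \<le> R"
    unfolding R_def using b by (intro real_le_rsqrt) (simp add: power2_eq_square)
  show "R \<le> 59 / 100"
    unfolding R_def using b by (intro real_le_lsqrt) (simp_all add: power2_eq_square)
  show "R\<^sup>2 = 1 - 1 / sqrt 2"
    unfolding R_def using b by (intro real_sqrt_pow2) linarith
qed

lemma r2rils_Suc: "t \<ge> 1 \<Longrightarrow> r2rils X s (Suc t) = r2rils_step X (r2rils X s t)"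
  by (cases t) (simp_all add: r2rils_def)

text \<open>The step bound is used in two phases. With the initial \<delta> it shows that
  correlations never fall below \<delta> and are at least 1/4 from the second iterate on. Then, with
  1/4 in place of \<delta>, it gives an affine recursion for the distance whose additive term is at
  most \<open>4 * C * (1 - R) * x\<close>, so that \<open>4 * C * x\<close> bounds the limiting
  error.\<close>

lemma r2rils_error:
  fixes u p :: "real^'m" and v q :: "real^'n" and Z :: "real^'n^'m"
  assumes u: "norm u = 1" and v: "norm v = 1" and p: "norm p = 1" and q: "norm q = 1"
    and X: "X = \<sigma> *\<^sub>R outer_product u v + Z" and \<sigma>: "0 < \<sigma>"
    and Z: "\<And>z. norm (Z *v z) \<le> (11 / 2 * \<eta>) * norm z" and \<eta>: "0 < \<eta>"
    and \<delta>: "0 < \<delta>" "\<delta> \<le> 1 / 4" "\<delta> \<le> u \<bullet> p" "\<delta> \<le> v \<bullet> q"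
    and R: "R = sqrt (1 - 1 / sqrt 2)" and C: "C = 50 / (1 - R)"
    and ratio: "\<eta> / \<sigma> \<le> sqrt 2 / C * \<delta>"
  shows "\<forall>t\<ge>1. r2rils_step_ok X (r2rils X (p, q) t)"
    and "\<forall>t\<ge>2. norm (r2rils X (p, q) t - (u, v))
      \<le> sqrt 3 * R ^ (t - 2) + 4 * C * (1 - R ^ (t - 2)) * (\<eta> / \<sigma>)"
proof -
  define x where "x = \<eta> / \<sigma>"
  have x0: "0 < x" using \<eta> \<sigma> by (simp add: x_def)
  have Rb: "1 / 2 \<le> R" "R \<le> 59 / 100"
    using rate_bounds R by simp_all
  have CR: "C * (1 - R) = 50"
    using Rb C by (intro nonzero_eq_divide_eq[THEN iffD1]) auto
  have C100: "100 \<le> C"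
    using Rb by (simp add: C field_simps)
  \<comment> \<open>The assumed operator norm bound \<open>11 / 2 * \<eta>\<close> divided by the
    least initial signal \<open>\<sigma> * \<delta>\<close>.\<close>
  define \<epsilon> where "\<epsilon> = 11 / 2 * x / \<delta>"
  have \<epsilon>0: "0 \<le> \<epsilon>" using x0 \<delta> by (simp add: \<epsilon>_def)
  have "x \<le> sqrt 2 / 100 * \<delta>"
  proof -
    have "sqrt 2 / C * \<delta> \<le> sqrt 2 / 100 * \<delta>"
      using C100 \<delta>(1) by (intro mult_right_mono divide_left_mono) auto
    with ratio show ?thesis unfolding x_def by (rule order_trans)
  qed
  then have \<epsilon>s: "\<epsilon> \<le> 11 / 200 * sqrt 2"
    using \<delta>(1) by (simp add: \<epsilon>_def field_simps)
  have "sqrt 2 \<le> 3 / 2" by (rule real_le_lsqrt) (simp_all add: power2_eq_square)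
  then have \<epsilon>8: "\<epsilon> \<le> 1 / 8" using \<epsilon>s by linarith
  have "4 * sqrt 2 * \<epsilon> \<le> 4 * sqrt 2 * (11 / 200 * sqrt 2)"
    using \<epsilon>s by (intro mult_left_mono) auto
  \<comment> \<open>The loss in correlation is at most 0.44, and 0.7 - 0.44 still exceeds
    1/4.\<close>
  then have quarter: "1 / 4 \<le> 1 / sqrt 2 - 4 * sqrt 2 * \<epsilon>"
    using rate_bounds(3) by simp
  have K1: "11 / 2 * \<eta> \<le> \<epsilon> * (\<sigma> * \<delta>)"
    using \<delta>(1) \<sigma> by (simp add: \<epsilon>_def x_def)
  \<comment> \<open>In the second phase the relative noise is \<open>22 * x\<close>, the value of
    \<epsilon> with 1/4 in place of \<delta>.\<close>
  have K2: "11 / 2 * \<eta> \<le> (22 * x) * (\<sigma> * (1 / 4))"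
    using \<sigma> by (simp add: x_def)
  have \<epsilon>2: "22 * x \<le> \<epsilon>"
  proof -
    have "22 * x * \<delta> \<le> 11 / 2 * x" using \<delta>(2) x0 by simp
    then show ?thesis using \<delta>(1) by (simp add: \<epsilon>_def pos_le_divide_eq)
  qed
  obtain pt qt where pq: "\<And>t. r2rils X (p, q) t = (pt t, qt t)"
    using that[of "\<lambda>t. fst (r2rils X (p, q) t)" "\<lambda>t. snd (r2rils X (p, q) t)"] by simp
  have start: "pt 1 = p" "qt 1 = q"
    using pq[of 1] by (simp_all add: r2rils_def)
  have stp: "r2rils_step X (pt t, qt t) = (pt (Suc t), qt (Suc t))" if "t \<ge> 1" for t
    using r2rils_Suc[OF that, of X "(p, q)"] by (simp add: pq)
  have good: "norm (pt t) = 1 \<and> norm (qt t) = 1 \<and> \<delta> \<le> u \<bullet> pt t \<and> \<delta> \<le> v \<bullet> qt t" if "t \<ge> 1" for t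
    using that
  proof (induction t rule: dec_induct)
    case base
    then show ?case using start p q \<delta> by simp
  next
    case (step t)
    then have "norm (pt t) = 1" "norm (qt t) = 1" "\<delta> \<le> u \<bullet> pt t" "\<delta> \<le> v \<bullet> qt t" by auto
    note r2rils_step_error[OF u v this(1,2) X \<sigma> Z \<delta>(1) this(3,4) K1 \<epsilon>0 \<epsilon>8 stp[OF step(1)]]
    then show ?case using quarter \<delta>(2) by auto
  qed
  have quart: "1 / 4 \<le> u \<bullet> pt (Suc t) \<and> 1 / 4 \<le> v \<bullet> qt (Suc t)" if "t \<ge> 1" for t
  proof -
    have "norm (pt t) = 1" "norm (qt t) = 1" "\<delta> \<le> u \<bullet> pt t" "\<delta> \<le> v \<bullet> qt t" using good[OF that] by auto
    note r2rils_step_error[OF u v this(1,2) X \<sigma> Z \<delta>(1) this(3,4) K1 \<epsilon>0 \<epsilon>8 stp[OF that]]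
    then show ?thesis using quarter by auto
  qed
  show "\<forall>t\<ge>1. r2rils_step_ok X (r2rils X (p, q) t)"
  proof (intro allI impI)
    fix t :: nat assume t: "1 \<le> t"
    have "norm (pt t) = 1" "norm (qt t) = 1" "\<delta> \<le> u \<bullet> pt t" "\<delta> \<le> v \<bullet> qt t" using good[OF t] by auto
    from r2rils_step_error(1)[OF u v this(1,2) X \<sigma> Z \<delta>(1) this(3,4) K1 \<epsilon>0 \<epsilon>8 stp[OF t]]
    show "r2rils_step_ok X (r2rils X (p, q) t)" by (simp add: pq)
  qed
  have bound: "norm ((pt t, qt t) - (u, v)) \<le> sqrt 3 * R ^ (t - 2) + 4 * C * (1 - R ^ (t - 2)) * x"
    if "t \<ge> 2" for t
    using that
  proof (induction t rule: dec_induct)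
    case base
    have g: "norm (pt 2) = 1" "norm (qt 2) = 1" "1 / 4 \<le> u \<bullet> pt 2" "1 / 4 \<le> v \<bullet> qt 2"
      using good[of 2] quart[of 1] by (simp_all add: numeral_2_eq_2)
    have n1: "pt 2 \<bullet> pt 2 = 1" "qt 2 \<bullet> qt 2 = 1" "u \<bullet> u = 1" "v \<bullet> v = 1"
      using g u v by (simp_all add: norm_eq_1)
    \<comment> \<open>Correlations of at least 1/4 in both factors make this at most 3, which is the
      origin of \<open>sqrt 3\<close> and of the exponent \<open>t - 2\<close>.\<close>
    have "(norm ((pt 2, qt 2) - (u, v)))\<^sup>2 = 4 - 2 * (u \<bullet> pt 2) - 2 * (v \<bullet> qt 2)"
      unfolding power2_norm_eq_inner
      by (simp add: inner_diff_left inner_diff_right n1 inner_commute)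
    also have "\<dots> \<le> 3" using g by linarith
    finally show ?case by (simp add: real_le_rsqrt)
  next
    case (step t)
    define r where "r = R ^ (t - 2)"
    have "Suc t - 2 = Suc (t - 2)" using step(1) by simp
    then have rS: "R ^ (Suc t - 2) = R * r" by (simp only: r_def power_Suc)
    have t1: "t \<ge> 1" using step(1) by simp
    have q4: "1 / 4 \<le> u \<bullet> pt t" "1 / 4 \<le> v \<bullet> qt t"
      using quart[of "t - 1"] step(1) by simp_all
    have "norm ((pt (Suc t), qt (Suc t)) - (u, v)) \<le> R * norm ((pt t, qt t) - (u, v)) + 8 * (22 * x)"
      using r2rils_step_error(6)[OF u v _ _ X \<sigma> Z _ q4 K2 _ _ stp[OF t1]] good[OF t1] x0 \<epsilon>2 \<epsilon>8
      unfolding R by simp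
    \<comment> \<open>The additive term 8 * 22 = 176 is rounded up to 200 = 4 * 50, and 50 is
      \<open>C * (1 - R)\<close>.\<close>
    also have "\<dots> \<le> R * (sqrt 3 * r + 4 * C * (1 - r) * x) + 4 * (C * (1 - R)) * x"
      using step.IH x0 Rb unfolding CR r_def by (intro add_mono mult_left_mono) auto
    also have "\<dots> = sqrt 3 * (R * r) + 4 * C * (1 - R * r) * x"
      by (simp add: algebra_simps)
    finally show ?case unfolding rS .
  qed
  then show "\<forall>t\<ge>2. norm (r2rils X (p, q) t - (u, v))
      \<le> sqrt 3 * R ^ (t - 2) + 4 * C * (1 - R ^ (t - 2)) * (\<eta> / \<sigma>)"
    by (simp add: pq x_def)
qed

text \<open>Since \<open>R ^ 3\<close> is below \<open>exp (- 1)\<close>,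
  \<open>3 * ln (1 / x)\<close> iterations bring \<open>R ^ t\<close> below \<open>x\<close>. The
  shift of the exponent by 2 costs at most 100/29, which with \<open>sqrt 3\<close> at most 29/10
  gives \<open>10 * x\<close>; the other term is at most \<open>490 * x\<close>.\<close>

lemma geometric_bound_after_log:
  assumes R: "R = sqrt (1 - 1 / sqrt 2)" and C: "C = 50 / (1 - R)"
    and x: "0 < x" "x \<le> 1 / 100" and t: "3 * ln (1 / x) \<le> real t"
  shows "2 \<le> t" and "sqrt 3 * R ^ (t - 2) + 4 * C * (1 - R ^ (t - 2)) * x \<le> 500 * x"
proof -
  have Rb: "1 / 2 \<le> R" "R \<le> 59 / 100" "R\<^sup>2 = 1 - 1 / sqrt 2"
    using rate_bounds R by simp_all
  have "exp 1 \<le> 1 / x"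
    using mult_mono[OF x(2) exp_le] x by (simp add: field_simps)
  then have "1 \<le> ln (1 / x)"
    using x by (simp add: ln_ge_iff)
  then show t2: "2 \<le> t" using t by linarith
  have "ln R \<le> - (1 / 3)"
  proof -
    have "ln (R ^ 3) \<le> ln (exp (- 1))"
    proof (rule ln_mono)
      have "R ^ 3 \<le> (59 / 100) ^ 3" using Rb by (intro power_mono) auto
      also have "\<dots> \<le> 1 / exp 1" using exp_le by (simp add: field_simps power3_eq_cube)
      finally show "R ^ 3 \<le> exp (- 1)" by (simp add: exp_minus inverse_eq_divide)
    qed (use Rb in auto)
    then show ?thesis using Rb by (simp add: ln_realpow)
  qed
  then have "real t * ln R \<le> real t * (- (1 / 3))"
    by (rule mult_left_mono) simp
  then have "real t * ln R \<le> ln x"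
    using t x by (simp add: ln_div)
  then have "exp (real t * ln R) \<le> exp (ln x)" by simp
  then have Rt: "R ^ t \<le> x"
    using Rb x by (simp add: exp_of_nat_mult)
  have R2: "29 / 100 \<le> R\<^sup>2"
  proof -
    have "sqrt 2 \<le> 142 / 100" by (rule real_le_lsqrt) (simp_all add: power2_eq_square)
    moreover have "1 / sqrt 2 = sqrt 2 / 2" by (simp add: real_div_sqrt field_simps)
    ultimately show ?thesis using Rb by simp
  qed
  have "R ^ t = R ^ (t - 2) * R\<^sup>2"
    using t2 by (simp only: power_add[symmetric] le_add_diff_inverse2)
  moreover have "R ^ (t - 2) * (29 / 100) \<le> R ^ (t - 2) * R\<^sup>2"
    using R2 by (rule mult_left_mono) (use Rb in simp)
  ultimately have "R ^ (t - 2) * (29 / 100) \<le> x"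
    using Rt by linarith
  moreover have "sqrt 3 \<le> 29 / 10" by (rule real_le_lsqrt) (simp_all add: power2_eq_square)
  then have "sqrt 3 * R ^ (t - 2) \<le> 29 / 10 * R ^ (t - 2)"
    using Rb by (intro mult_right_mono) auto
  ultimately have 1: "sqrt 3 * R ^ (t - 2) \<le> 10 * x" by linarith
  have C4: "0 \<le> 4 * C" "4 * C \<le> 490"
    using Rb by (simp_all add: C field_simps)
  have "0 \<le> R ^ (t - 2)" using Rb by simp
  then have "4 * C * (1 - R ^ (t - 2)) \<le> 4 * C * 1"
    using C4 by (intro mult_left_mono) auto
  then have "4 * C * (1 - R ^ (t - 2)) * x \<le> 490 * x"
    using C4 x by (intro mult_right_mono) auto
  then show "sqrt 3 * R ^ (t - 2) + 4 * C * (1 - R ^ (t - 2)) * x \<le> 500 * x"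
    using 1 by linarith
qed

section \<open>The operator norm of a Gaussian matrix\<close>

text \<open>Completing the square: tilting the density by \<open>exp (t * x)\<close> moves its mean
  to \<open>\<sigma>\<^sup>2 * t\<close> and leaves the constant on the right.\<close>

lemma normal_density_mgf:
  assumes "\<sigma> > 0"
  shows "(\<integral>\<^sup>+ x. ennreal (normal_density 0 \<sigma> x) * ennreal (exp (t * x)) \<partial>lborel) = ennreal (exp (\<sigma>\<^sup>2 * t\<^sup>2 / 2))"
proof -
  have eq: "normal_density 0 \<sigma> x * exp (t * x) = exp (\<sigma>\<^sup>2 * t\<^sup>2 / 2) * normal_density (\<sigma>\<^sup>2 * t) \<sigma> x" for x
  proof -
    have "- (x\<^sup>2 / (2 * \<sigma>\<^sup>2)) + t * x = \<sigma>\<^sup>2 * t\<^sup>2 / 2 + - ((x - \<sigma>\<^sup>2 * t)\<^sup>2 / (2 * \<sigma>\<^sup>2))"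
      using assms by (simp add: field_simps power2_eq_square)
    then have "exp (- (x\<^sup>2 / (2 * \<sigma>\<^sup>2))) * exp (t * x) = exp (\<sigma>\<^sup>2 * t\<^sup>2 / 2) * exp (- ((x - \<sigma>\<^sup>2 * t)\<^sup>2 / (2 * \<sigma>\<^sup>2)))"
      by (simp only: exp_add[symmetric])
    then show ?thesis
      by (simp add: normal_density_def)
  qed
  have "(\<integral>\<^sup>+ x. ennreal (normal_density 0 \<sigma> x) * ennreal (exp (t * x)) \<partial>lborel)
    = (\<integral>\<^sup>+ x. ennreal (exp (\<sigma>\<^sup>2 * t\<^sup>2 / 2)) * ennreal (normal_density (\<sigma>\<^sup>2 * t) \<sigma> x) \<partial>lborel)"
    by (intro nn_integral_cong) (simp add: ennreal_mult'[symmetric] eq)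
  also have "\<dots> = ennreal (exp (\<sigma>\<^sup>2 * t\<^sup>2 / 2)) * (\<integral>\<^sup>+ x. ennreal (normal_density (\<sigma>\<^sup>2 * t) \<sigma> x) \<partial>lborel)"
    by (rule nn_integral_cmult) simp
  also have "(\<integral>\<^sup>+ x. ennreal (normal_density (\<sigma>\<^sup>2 * t) \<sigma> x) \<partial>lborel) = 1"
    using assms by (subst nn_integral_eq_integral) auto
  finally show ?thesis by simp
qed

lemma borel_measurable_vec_iff:
  fixes f :: "'a \<Rightarrow> 'c::euclidean_space^'n"
  shows "f \<in> borel_measurable M \<longleftrightarrow> (\<forall>i. (\<lambda>x. f x $ i) \<in> borel_measurable M)"
proof
  show "\<forall>i. (\<lambda>x. f x $ i) \<in> borel_measurable M" if "f \<in> borel_measurable M"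
  proof
    fix i
    have "(\<lambda>y :: 'c^'n. y $ i) \<in> borel_measurable borel"
      by (intro borel_measurable_continuous_onI continuous_intros)
    from measurable_compose[OF that this] show "(\<lambda>x. f x $ i) \<in> borel_measurable M" .
  qed
next
  assume *: "\<forall>i. (\<lambda>x. f x $ i) \<in> borel_measurable M"
  show "f \<in> borel_measurable M"
  proof (rule borel_measurable_euclidean_space[THEN iffD2], rule ballI)
    fix b :: "'c^'n" assume "b \<in> Basis"
    then obtain i u where b: "b = axis i u" by (auto simp: Basis_vec_def)
    show "(\<lambda>x. f x \<bullet> b) \<in> borel_measurable M"
      unfolding b inner_axis using * by (intro borel_measurable_inner) auto
  qed
qed

text \<open>The bilinear form is a sum of independent centred Gaussians with coefficients
  \<open>x $ i * y $ j\<close>, whose squares sum to the product of the squared norms. Nonnegative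
  integrals avoid integrability conditions.\<close>

lemma (in prob_space) gaussian_bilinear_mgf:
  fixes Z :: "'a \<Rightarrow> real^'n^'m"
  assumes indep: "indep_vars (\<lambda>_. borel) (\<lambda>(i, j) \<omega>. Z \<omega> $ i $ j) (UNIV :: ('m \<times> 'n) set)"
    and gauss: "\<And>i j. distributed M lborel (\<lambda>\<omega>. Z \<omega> $ i $ j) (normal_density 0 s)"
    and s: "s > 0"
  shows "(\<integral>\<^sup>+ \<omega>. ennreal (exp (x \<bullet> (Z \<omega> *v y))) \<partial>M) = ennreal (exp (s\<^sup>2 * (norm x)\<^sup>2 * (norm y)\<^sup>2 / 2))"
proof -
  define Y where "Y = (\<lambda>(i, j) \<omega>. ennreal (exp ((x $ i * y $ j) * Z \<omega> $ i $ j)))"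
  have "x \<bullet> (Z \<omega> *v y) = (\<Sum>(i, j)\<in>UNIV. (x $ i * y $ j) * Z \<omega> $ i $ j)" for \<omega>
    by (simp add: inner_vec_def matrix_vector_mult_def sum_distrib_left sum.cartesian_product ac_simps)
  then have "(\<integral>\<^sup>+ \<omega>. ennreal (exp (x \<bullet> (Z \<omega> *v y))) \<partial>M) = (\<integral>\<^sup>+ \<omega>. (\<Prod>p\<in>UNIV. Y p \<omega>) \<partial>M)"
    by (simp add: Y_def exp_sum prod_ennreal case_prod_unfold)
  also have "\<dots> = (\<Prod>p\<in>UNIV. \<integral>\<^sup>+ \<omega>. Y p \<omega> \<partial>M)"
  proof (rule indep_vars_nn_integral)
    have "indep_vars (\<lambda>_. borel) (\<lambda>p \<omega>. (\<lambda>z. ennreal (exp ((x $ fst p * y $ snd p) * z)))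
        ((\<lambda>(i, j) \<omega>. Z \<omega> $ i $ j) p \<omega>)) UNIV"
      by (rule indep_vars_compose2[OF indep]) measurable
    then show "indep_vars (\<lambda>_. borel) Y UNIV"
      by (simp add: Y_def case_prod_unfold)
  qed auto
  also have "\<dots> = (\<Prod>p\<in>UNIV. ennreal (exp (s\<^sup>2 * (x $ fst p * y $ snd p)\<^sup>2 / 2)))"
  proof (intro prod.cong refl)
    fix p :: "'m \<times> 'n"
    obtain i j where p: "p = (i, j)" by fastforce
    have "(\<integral>\<^sup>+ \<omega>. Y p \<omega> \<partial>M) = (\<integral>\<^sup>+ z. ennreal (normal_density 0 s z) * ennreal (exp ((x $ i * y $ j) * z)) \<partial>lborel)"
      by (simp add: p Y_def) (rule distributed_nn_integral[OF gauss, symmetric], measurable)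
    then show "(\<integral>\<^sup>+ \<omega>. Y p \<omega> \<partial>M) = ennreal (exp (s\<^sup>2 * (x $ fst p * y $ snd p)\<^sup>2 / 2))"
      using normal_density_mgf[OF s] by (simp add: p)
  qed
  also have "\<dots> = ennreal (exp (\<Sum>p\<in>UNIV. s\<^sup>2 * (x $ fst p * y $ snd p)\<^sup>2 / 2))"
    by (simp add: exp_sum prod_ennreal)
  also have "(\<Sum>p\<in>UNIV. s\<^sup>2 * (x $ fst p * y $ snd p)\<^sup>2 / 2) = s\<^sup>2 * ((norm x)\<^sup>2 * (norm y)\<^sup>2) / 2"
  proof -
    have "(norm x)\<^sup>2 * (norm y)\<^sup>2 = (\<Sum>p\<in>UNIV. (x $ fst p * y $ snd p)\<^sup>2)"
      unfolding power2_norm_eq_inner inner_vec_def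
      by (simp add: sum_product sum.cartesian_product case_prod_unfold power2_eq_square ac_simps)
    then show ?thesis by (simp add: sum_distrib_left sum_divide_distrib)
  qed
  finally show ?thesis by (simp add: mult.assoc)
qed

text \<open>Expanding around \<open>(x0, y0)\<close> leaves two linear errors and one quadratic
  error. For \<epsilon> = 1/10 and value \<open>K\<close> at the centre, 1 - 0.21 gives the factor
  79/100 used below.\<close>

lemma bilinear_near_unit_vectors:
  fixes Z :: "real^'n^'m"
  assumes x: "norm x0 = 1" "norm (x - x0) \<le> \<epsilon>" and y: "norm y0 = 1" "norm (y - y0) \<le> \<epsilon>"
    and le: "\<And>z. norm (Z *v z) \<le> K * norm z"
  shows "x0 \<bullet> (Z *v y0) - K * (2 * \<epsilon> + \<epsilon>\<^sup>2) \<le> x \<bullet> (Z *v y)"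
proof -
  have eps: "0 \<le> \<epsilon>" using x(2) norm_ge_zero order_trans by blast
  have K: "0 \<le> K"
    using order_trans[OF norm_ge_zero le[of y0]] y(1) by simp
  define a b where "a = x - x0" and "b = y - y0"
  have bil: "\<bar>c \<bullet> (Z *v d)\<bar> \<le> K * (norm c * norm d)" for c d
  proof -
    have "\<bar>c \<bullet> (Z *v d)\<bar> \<le> norm c * norm (Z *v d)"
      by (rule Cauchy_Schwarz_ineq2)
    also have "\<dots> \<le> norm c * (K * norm d)"
      by (intro mult_left_mono le) simp
    finally show ?thesis by (simp add: ac_simps)
  qed
  have "x \<bullet> (Z *v y) = x0 \<bullet> (Z *v y0) + x0 \<bullet> (Z *v b) + a \<bullet> (Z *v y0) + a \<bullet> (Z *v b)"
    by (simp add: a_def b_def matrix_vector_mult_diff_distrib inner_diff_left inner_diff_right)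
  moreover have "norm x0 * norm b \<le> \<epsilon>" "norm a * norm y0 \<le> \<epsilon>" "norm a * norm b \<le> \<epsilon> * \<epsilon>"
    using x y eps by (auto simp: a_def b_def intro!: mult_mono)
  then have "K * (norm x0 * norm b) + K * (norm a * norm y0) + K * (norm a * norm b)
      \<le> K * \<epsilon> + K * \<epsilon> + K * (\<epsilon> * \<epsilon>)"
    by (intro add_mono mult_left_mono K)
  moreover have "K * \<epsilon> + K * \<epsilon> + K * (\<epsilon> * \<epsilon>) = K * (2 * \<epsilon> + \<epsilon>\<^sup>2)"
    by (simp add: algebra_simps power2_eq_square)
  ultimately show ?thesis
    using bil[of x0 b] bil[of a y0] bil[of a b] by linarith
qed

text \<open>Averaging \<open>exp (l x\<^sup>T Z y)\<close> over two balls replaces a union bound over nets: if \<open>Z\<close> has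
  large operator norm, the integrand is large near a pair of extremal unit vectors. The radius
  \<open>11/10\<close> leaves room for balls of radius \<open>1/10\<close> around unit vectors.\<close>

definition exp_bilinear_integral :: "real \<Rightarrow> real^'n^'m \<Rightarrow> ennreal" where
  "exp_bilinear_integral l Z =
    (\<integral>\<^sup>+ p. ennreal (exp (l * (fst p \<bullet> (Z *v snd p)))) * indicator (cball 0 (11/10) \<times> cball 0 (11/10)) p \<partial>lborel)"

lemma emeasure_lborel_Times:
  fixes A :: "'a::euclidean_space set" and B :: "'b::euclidean_space set"
  assumes "A \<in> sets borel" "B \<in> sets borel"
  shows "emeasure lborel (A \<times> B) = emeasure lborel A * emeasure lborel B"
  using assms by (simp add: lborel_prod[symmetric] lborel.emeasure_pair_measure_Times)

text \<open>Compactness supplies unit vectors at which the bilinear form equals the operator norm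
  \<open>K\<close>. The integral is at least its part over balls of radius 1/10 around them, where
  the form is at least \<open>79 / 100 * K\<close>.\<close>

lemma exp_bilinear_integral_ge:
  fixes Z :: "real^'n^'m"
  assumes l: "0 < l" and K: "onorm ((*v) Z) = K"
  shows "ennreal (unit_ball_vol (real CARD('m)) * unit_ball_vol (real CARD('n)) *
      (1 / 10) ^ (CARD('m) + CARD('n)) * exp (l * K * (79 / 100))) \<le> exp_bilinear_integral l Z"
proof -
  have bl: "bounded_linear ((*v) Z)" by simp
  obtain y0 :: "real^'n" where y0: "norm y0 = 1" "norm (Z *v y0) = K"
  proof -
    have "compact (sphere 0 1 :: (real^'n) set)" by simp
    moreover have "sphere 0 1 \<noteq> ({} :: (real^'n) set)" by simp
    moreover have "continuous_on (sphere 0 1) (\<lambda>y. norm (Z *v y))"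
      by (intro continuous_intros)
    ultimately obtain y where y: "y \<in> sphere 0 1"
        "\<And>z. z \<in> sphere 0 1 \<Longrightarrow> norm (Z *v z) \<le> norm (Z *v y)"
      using continuous_attains_sup by metis
    have "norm (Z *v z) \<le> norm (Z *v y) * norm z" for z
    proof (cases "z = 0")
      case False
      have "norm (Z *v (z /\<^sub>R norm z)) \<le> norm (Z *v y)"
        using False by (intro y(2)) simp
      then show ?thesis
        using False by (simp add: matrix_vector_mult_scaleR field_simps)
    qed simp
    then have "K \<le> norm (Z *v y)"
      unfolding K[symmetric] by (rule onorm_le)
    moreover have "norm (Z *v y) \<le> K"
      using onorm[OF bl, of y] y(1) by (simp add: K)
    ultimately show ?thesis using that[of y] y(1) by simp
  qed
  have le: "norm (Z *v z) \<le> K * norm z" for z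
    using onorm[OF bl, of z] by (simp add: K)
  \<comment> \<open>The natural choice is the direction of \<open>Z *v y0\<close>; if
    \<open>K = 0\<close>, any unit vector serves.\<close>
  obtain x0 :: "real^'m" where x0: "norm x0 = 1" "x0 \<bullet> (Z *v y0) = K"
  proof (cases "K = 0")
    case True
    then show ?thesis
      using that[of "axis undefined 1"] y0 by (simp add: norm_axis_1)
  next
    case False
    then have "0 < K" using y0(2) norm_ge_zero[of "Z *v y0"] by linarith
    then show ?thesis
      using that[of "(Z *v y0) /\<^sub>R K"] y0 by (simp add: dot_square_norm power2_eq_square)
  qed
  let ?B = "cball x0 (1/10) \<times> cball y0 (1/10)"
  let ?e = "ennreal (exp (l * K * (79 / 100)))"
  have vol: "emeasure lborel ?B = ennreal (unit_ball_vol (real CARD('m)) * unit_ball_vol (real CARD('n)) *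
      (1 / 10) ^ (CARD('m) + CARD('n)))"
    by (simp add: emeasure_lborel_Times emeasure_cball ennreal_mult'[symmetric] power_add ac_simps)
  have B: "?B \<in> sets borel"
    by (rule borel_closed) (intro closed_Times closed_cball)
  have "ennreal (unit_ball_vol (real CARD('m)) * unit_ball_vol (real CARD('n)) *
      (1 / 10) ^ (CARD('m) + CARD('n)) * exp (l * K * (79 / 100))) = ?e * emeasure lborel ?B"
    unfolding vol by (simp add: ennreal_mult'[symmetric] ac_simps)
  also have "\<dots> = (\<integral>\<^sup>+ p. ?e * indicator ?B p \<partial>lborel)"
    using B by (subst nn_integral_cmult_indicator) auto
  also have "\<dots> \<le> exp_bilinear_integral l Z"
    unfolding exp_bilinear_integral_def
  proof (intro nn_integral_mono)
    fix p :: "(real^'m) \<times> (real^'n)"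
    obtain x y where p: "p = (x, y)" by fastforce
    show "?e * indicator ?B p \<le> ennreal (exp (l * (fst p \<bullet> (Z *v snd p)))) *
        indicator (cball 0 (11/10) \<times> cball 0 (11/10)) p"
    proof (cases "p \<in> ?B")
      case True
      then have d: "norm (x - x0) \<le> 1 / 10" "norm (y - y0) \<le> 1 / 10"
        by (auto simp: p dist_norm norm_minus_commute)
      have "K * (79 / 100) \<le> x \<bullet> (Z *v y)"
        using bilinear_near_unit_vectors[OF x0(1) d(1) y0(1) d(2) le] x0(2)
        by (simp add: power2_eq_square)
      then have "l * (K * (79 / 100)) \<le> l * (x \<bullet> (Z *v y))"
        using l by simp
      moreover have "p \<in> cball 0 (11/10) \<times> cball 0 (11/10)"
        using d x0 y0 norm_triangle_ineq[of "x - x0" x0] norm_triangle_ineq[of "y - y0" y0]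
        by (simp add: p)
      ultimately show ?thesis
        using True by (simp add: p)
    qed simp
  qed
  finally show ?thesis .
qed

context prob_space
begin

context
  fixes Z :: "'a \<Rightarrow> real^'n^'m" and s :: real
  assumes indep: "indep_vars (\<lambda>_. borel) (\<lambda>(i, j) \<omega>. Z \<omega> $ i $ j) (UNIV :: ('m \<times> 'n) set)"
    and gauss: "\<And>i j. distributed M lborel (\<lambda>\<omega>. Z \<omega> $ i $ j) (normal_density 0 s)"
    and s: "s > 0"
begin

lemma gaussian_matrix_measurable: "Z \<in> borel_measurable M"
  using distributed_measurable[OF gauss] by (simp add: borel_measurable_vec_iff)

lemma measurable_exp_bilinear:
  "(\<lambda>(\<omega>, p). ennreal (exp (l * (fst p \<bullet> (Z \<omega> *v snd p)))) *
      indicator (cball 0 (11/10) \<times> cball 0 (11/10)) p) \<in> borel_measurable (M \<Otimes>\<^sub>M lborel)"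
proof -
  have [measurable]: "Z \<in> borel_measurable M" by (rule gaussian_matrix_measurable)
  have "(\<lambda>q. fst (snd q) \<bullet> (Z (fst q) *v snd (snd q))) \<in> borel_measurable (M \<Otimes>\<^sub>M lborel)"
  proof -
    have "continuous_on UNIV (\<lambda>r :: (real^'n^'m) \<times> ((real^'m) \<times> (real^'n)). fst (snd r) \<bullet> (fst r *v snd (snd r)))"
      unfolding inner_vec_def matrix_vector_mult_def by (intro continuous_intros) 
    then have c: "(\<lambda>r :: (real^'n^'m) \<times> ((real^'m) \<times> (real^'n)). fst (snd r) \<bullet> (fst r *v snd (snd r))) \<in> borel_measurable borel"
      by (rule borel_measurable_continuous_onI)
    have "(\<lambda>q. (Z (fst q), snd q)) \<in> (M \<Otimes>\<^sub>M lborel) \<rightarrow>\<^sub>M borel"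
      by measurable
    from measurable_compose[OF this c] show ?thesis by simp
  qed
  moreover have "(cball 0 (11/10) \<times> cball 0 (11/10) :: ((real^'m) \<times> (real^'n)) set) \<in> sets borel"
    by (rule borel_closed) (intro closed_Times closed_cball)
  ultimately show ?thesis
    unfolding case_prod_unfold by measurable
qed

lemma measurable_exp_bilinear_integral:
  "(\<lambda>\<omega>. exp_bilinear_integral l (Z \<omega>)) \<in> borel_measurable M"
  unfolding exp_bilinear_integral_def
  by (rule sigma_finite_measure.borel_measurable_nn_integral[OF sigma_finite_lborel measurable_exp_bilinear])

text \<open>Tonelli moves the expectation inside, where the Gaussian moment generating function
  applies pointwise. With both norms at most 11/10 its exponent is at most
  \<open>l\<^sup>2 * s\<^sup>2\<close> times half of (11/10)^4, that is 14641/20000.\<close>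

lemma nn_integral_exp_bilinear_integral_le:
  "(\<integral>\<^sup>+ \<omega>. exp_bilinear_integral l (Z \<omega>) \<partial>M)
    \<le> ennreal (unit_ball_vol (real CARD('m)) * unit_ball_vol (real CARD('n)) * (11 / 10) ^ (CARD('m) + CARD('n)) *
        exp (l\<^sup>2 * s\<^sup>2 * (14641 / 20000)))"
proof -
  let ?B = "cball 0 (11/10) \<times> cball 0 (11/10) :: ((real^'m) \<times> (real^'n)) set"
  let ?e = "ennreal (exp (l\<^sup>2 * s\<^sup>2 * (14641 / 20000)))"
  have B: "?B \<in> sets borel"
    by (rule borel_closed) (intro closed_Times closed_cball)
  interpret pair_sigma_finite M "lborel :: ((real^'m) \<times> (real^'n)) measure"
    by (intro pair_sigma_finite.intro sigma_finite_measure_axioms sigma_finite_lborel)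
  have "(\<integral>\<^sup>+ \<omega>. exp_bilinear_integral l (Z \<omega>) \<partial>M)
    = (\<integral>\<^sup>+ p. (\<integral>\<^sup>+ \<omega>. ennreal (exp (l * (fst p \<bullet> (Z \<omega> *v snd p)))) * indicator ?B p \<partial>M) \<partial>lborel)"
    unfolding exp_bilinear_integral_def
    using Fubini'[OF measurable_exp_bilinear, of l] by simp
  also have "\<dots> \<le> (\<integral>\<^sup>+ p. ?e * indicator ?B p \<partial>lborel)"
  proof (intro nn_integral_mono)
    fix p :: "(real^'m) \<times> (real^'n)"
    obtain x y where p: "p = (x, y)" by fastforce
    show "(\<integral>\<^sup>+ \<omega>. ennreal (exp (l * (fst p \<bullet> (Z \<omega> *v snd p)))) * indicator ?B p \<partial>M) \<le> ?e * indicator ?B p"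
    proof (cases "p \<in> ?B")
      case True
      have "(\<integral>\<^sup>+ \<omega>. ennreal (exp (l * (x \<bullet> (Z \<omega> *v y)))) \<partial>M) = (\<integral>\<^sup>+ \<omega>. ennreal (exp ((l *\<^sub>R x) \<bullet> (Z \<omega> *v y))) \<partial>M)"
        by simp
      also have "\<dots> = ennreal (exp (s\<^sup>2 * (norm (l *\<^sub>R x))\<^sup>2 * (norm y)\<^sup>2 / 2))"
        by (rule gaussian_bilinear_mgf[OF indep gauss s])
      also have "\<dots> \<le> ?e"
      proof -
        have "(norm x)\<^sup>2 * (norm y)\<^sup>2 \<le> (11 / 10)\<^sup>2 * (11 / 10)\<^sup>2"
          using True by (intro mult_mono power_mono) (auto simp: p)
        then have "(l\<^sup>2 * s\<^sup>2) * ((norm x)\<^sup>2 * (norm y)\<^sup>2) \<le> (l\<^sup>2 * s\<^sup>2) * ((11 / 10)\<^sup>2 * (11 / 10)\<^sup>2)"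
          by (rule mult_left_mono) simp
        then show ?thesis
          by (simp add: power_mult_distrib ac_simps power_divide)
      qed
      finally show ?thesis using True by (simp add: p)
    qed simp
  qed
  also have "\<dots> = ?e * emeasure lborel ?B"
    using B by (subst nn_integral_cmult_indicator) auto
  also have "\<dots> = ennreal (unit_ball_vol (real CARD('m)) * unit_ball_vol (real CARD('n)) * (11 / 10) ^ (CARD('m) + CARD('n)) *
        exp (l\<^sup>2 * s\<^sup>2 * (14641 / 20000)))"
    by (simp add: emeasure_lborel_Times emeasure_cball ennreal_mult'[symmetric] power_add ac_simps)
  finally show ?thesis .
qed

text \<open>Markov's inequality compares the mean of the averaged exponential with its value forced
  by a large operator norm. Producing a measurable set \<open>E\<close> avoids having to prove that
  the operator norm is measurable.\<close>

lemma gaussian_matrix_onorm_bound: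
  assumes card: "CARD('m) \<le> CARD('n)"
  shows "\<exists>E \<in> sets M. prob E \<ge> 1 - exp (- (real CARD('n) / 2)) \<and>
    (\<forall>\<omega>\<in>E. onorm ((*v) (Z \<omega>)) \<le> 11 / 2 * (s * sqrt (real CARD('n))))"
proof -
  define n where "n = real CARD('n)"
  have n: "n > 0" by (simp add: n_def)
  \<comment> \<open>A value close to the minimizer of the final exponent, which is quadratic in
    \<open>l\<close>.\<close>
  define l where "l = 14 / 5 * sqrt n / s"
  have l: "l > 0" using n s by (simp add: l_def)
  define V where "V = unit_ball_vol (real CARD('m)) * unit_ball_vol (real CARD('n))"
  have V: "V > 0" by (simp add: V_def)
  define \<kappa> where "\<kappa> = 11 / 2 * (s * sqrt n)"
  define c where "c = V * (1 / 10) ^ (CARD('m) + CARD('n)) * exp (l * \<kappa> * (79 / 100))"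
  have c: "c > 0" using V by (simp add: c_def)
  define A where "A = {\<omega> \<in> space M. 1 \<le> ennreal (1 / c) * exp_bilinear_integral l (Z \<omega>)}"
  have A: "A \<in> sets M"
    unfolding A_def using measurable_exp_bilinear_integral by measurable
  have "emeasure M A \<le> ennreal (1 / c) * (\<integral>\<^sup>+ \<omega>. exp_bilinear_integral l (Z \<omega>) * indicator (space M) \<omega> \<partial>M)"
    unfolding A_def
  proof (rule nn_integral_Markov_inequality)
    show "(\<lambda>\<omega>. exp_bilinear_integral l (Z \<omega>) * indicator (space M) \<omega>) \<in> borel_measurable M"
      using measurable_exp_bilinear_integral[of l] by measurable
  qed simp
  also have "(\<integral>\<^sup>+ \<omega>. exp_bilinear_integral l (Z \<omega>) * indicator (space M) \<omega> \<partial>M)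
      = (\<integral>\<^sup>+ \<omega>. exp_bilinear_integral l (Z \<omega>) \<partial>M)"
    by (intro nn_integral_cong) simp
  also have "ennreal (1 / c) * \<dots> \<le> ennreal (1 / c) *
      ennreal (V * (11 / 10) ^ (CARD('m) + CARD('n)) * exp (l\<^sup>2 * s\<^sup>2 * (14641 / 20000)))"
    unfolding V_def by (intro mult_left_mono nn_integral_exp_bilinear_integral_le) simp
  also have "\<dots> = ennreal (11 ^ (CARD('m) + CARD('n)) * exp (l\<^sup>2 * s\<^sup>2 * (14641 / 20000) - l * \<kappa> * (79 / 100)))"
  proof -
    have "1 / (V * (1 / 10) ^ N * exp b) * (V * (11 / 10) ^ N * exp a) = 11 ^ N * exp (a - b)" for a b :: real and N
      using V by (simp add: exp_diff power_divide field_simps)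
    then show ?thesis
      unfolding c_def using V c by (subst ennreal_mult'[symmetric]) (simp_all add: c_def)
  qed
  also have "\<dots> \<le> ennreal (exp (- (n / 2)))"
  proof (rule ennreal_leI)
    \<comment> \<open>The balls have radii 11/10 and 1/10, so their volumes contribute a factor 11
      per dimension, in at most \<open>2 * n\<close> dimensions. The final exponent is then about
      5.40 + 5.74 - 12.17 = -1.03 times \<open>n\<close>, below -1/2.\<close>
    have "(11::real) \<le> exp (27 / 10)"
    proof -
      have "(11 :: real) \<le> (109 / 100) ^ 30"
        by (simp add: power_divide)
      also have "(109 / 100 :: real) ^ 30 \<le> exp (9 / 100) ^ 30"
        using exp_ge_add_one_self[of "9 / 100 :: real"] by (intro power_mono) auto
      also have "\<dots> = exp (27 / 10)"
        by (simp add: exp_of_nat_mult[symmetric])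
      finally show ?thesis .
    qed
    then have "(11::real) ^ (CARD('m) + CARD('n)) \<le> exp (27 / 10) ^ (CARD('m) + CARD('n))"
      by (intro power_mono) auto
    also have "\<dots> \<le> exp (27 / 10) ^ (2 * CARD('n))"
      using card by (intro power_increasing) auto
    also have "\<dots> = exp (27 / 5 * n)"
      by (simp add: exp_of_nat_mult[symmetric] n_def)
    finally have le: "(11::real) ^ (CARD('m) + CARD('n)) \<le> exp (27 / 5 * n)" .
    have eq: "l\<^sup>2 * s\<^sup>2 = 196 / 25 * n" "l * \<kappa> = 77 / 5 * n"
      using s n by (simp_all add: l_def \<kappa>_def power_mult_distrib power_divide)
    have "11 ^ (CARD('m) + CARD('n)) * exp (l\<^sup>2 * s\<^sup>2 * (14641 / 20000) - l * \<kappa> * (79 / 100))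
      \<le> exp (27 / 5 * n) * exp (196 / 25 * n * (14641 / 20000) - 77 / 5 * n * (79 / 100))"
      unfolding eq by (rule mult_right_mono[OF le]) simp
    also have "\<dots> \<le> exp (- (n / 2))"
      unfolding exp_add[symmetric] using n by simp
    finally show "11 ^ (CARD('m) + CARD('n)) * exp (l\<^sup>2 * s\<^sup>2 * (14641 / 20000) - l * \<kappa> * (79 / 100)) \<le> exp (- (n / 2))" .
  qed
  finally have pA: "prob A \<le> exp (- (n / 2))"
    by (simp add: emeasure_eq_measure)
  have "onorm ((*v) (Z \<omega>)) \<le> \<kappa>" if "\<omega> \<in> space M - A" for \<omega>
  proof (rule ccontr)
    let ?K = "onorm ((*v) (Z \<omega>))"
    assume "\<not> ?K \<le> \<kappa>"
    then have "c \<le> V * (1 / 10) ^ (CARD('m) + CARD('n)) * exp (l * ?K * (79 / 100))"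
      unfolding c_def using V l by (intro mult_left_mono) auto
    then have "ennreal c \<le> exp_bilinear_integral l (Z \<omega>)"
      using exp_bilinear_integral_ge[OF l refl, of "Z \<omega>"] unfolding V_def
      by (meson ennreal_leI order_trans)
    then have "ennreal (1 / c) * ennreal c \<le> ennreal (1 / c) * exp_bilinear_integral l (Z \<omega>)"
      by (rule mult_left_mono) simp
    moreover have "ennreal (1 / c) * ennreal c = 1"
      using c by (simp add: ennreal_mult'[symmetric])
    ultimately show False
      using that by (simp add: A_def)
  qed
  then show ?thesis
    using A pA prob_compl[OF A] by (intro bexI[of _ "space M - A"]) (auto simp: n_def \<kappa>_def)
qed

end

end

section \<open>Measurability of the iterates\<close>

text \<open>The step with the least squares solution replaced by its closed form, which is measurable in
  all arguments. It agrees with \<^const>\<open>r2rils_step\<close> on unit vectors only, so the two sequences of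
  iterates are compared as long as no step breaks down.\<close>

definition explicit_step :: "real^'n^'m \<Rightarrow> (real^'m) \<times> (real^'n) \<Rightarrow> (real^'m) \<times> (real^'n)" where
  "explicit_step X s = (col_norm (fst s + col_norm (fst (lsq_sol X s))),
                        col_norm (snd s + col_norm (snd (lsq_sol X s))))"

definition explicit_step_ok :: "real^'n^'m \<Rightarrow> (real^'m) \<times> (real^'n) \<Rightarrow> bool" where
  "explicit_step_ok X s \<longleftrightarrow> fst (lsq_sol X s) \<noteq> 0 \<and> snd (lsq_sol X s) \<noteq> 0 \<and>
     fst s + col_norm (fst (lsq_sol X s)) \<noteq> 0 \<and> snd s + col_norm (snd (lsq_sol X s)) \<noteq> 0"

lemma r2rils_step_explicit:
  assumes "norm (fst s) = 1" "norm (snd s) = 1"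
  shows "r2rils_step X s = explicit_step X s"
    and "r2rils_step_ok X s \<longleftrightarrow> explicit_step_ok X s"
proof -
  obtain p q y z where s: "s = (p, q)" "lsq_sol X (p, q) = (y, z)"
    by (metis surj_pair)
  have "min_norm_lsq X (p, q) = (y, z)"
    using min_norm_lsq_eq[of p q X] assms by (simp add: s)
  then show "r2rils_step X s = explicit_step X s"
    and "r2rils_step_ok X s \<longleftrightarrow> explicit_step_ok X s"
    by (simp_all add: r2rils_step_def r2rils_step_ok_def explicit_step_def explicit_step_ok_def s)
qed

text \<open>A step that does not break down returns unit vectors, and on unit vectors both steps and
  both breakdown conditions coincide. The disjunction lets either sequence certify this, as needed
  to show that two events are equal.\<close>

lemma funpow_r2rils_step_explicit:
  assumes "norm (fst s) = 1" "norm (snd s) = 1"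
    and "(\<forall>k<n. r2rils_step_ok X ((r2rils_step X ^^ k) s)) \<or>
      (\<forall>k<n. explicit_step_ok X ((explicit_step X ^^ k) s))"
  shows "(r2rils_step X ^^ n) s = (explicit_step X ^^ n) s \<and>
    norm (fst ((r2rils_step X ^^ n) s)) = 1 \<and> norm (snd ((r2rils_step X ^^ n) s)) = 1"
  using assms(3)
proof (induction n)
  case 0
  then show ?case using assms by simp
next
  case (Suc n)
  define s' where "s' = (r2rils_step X ^^ n) s"
  have IH: "s' = (explicit_step X ^^ n) s" "norm (fst s') = 1" "norm (snd s') = 1"
    unfolding s'_def using Suc.prems by (auto simp: less_Suc_eq intro!: Suc.IH[THEN conjunct1]
      Suc.IH[THEN conjunct2, THEN conjunct1] Suc.IH[THEN conjunct2, THEN conjunct2])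
  have "r2rils_step_ok X s' \<or> explicit_step_ok X s'"
    using Suc.prems IH(1) by (auto simp: s'_def)
  then have "explicit_step_ok X s'"
    using r2rils_step_explicit(2)[OF IH(2,3)] by auto
  then have "norm (fst (explicit_step X s')) = 1 \<and> norm (snd (explicit_step X s')) = 1"
    by (simp add: explicit_step_def explicit_step_ok_def norm_col_norm)
  then show ?case
    using r2rils_step_explicit(1)[OF IH(2,3)] IH(1) by (simp add: s'_def)
qed

lemma r2rils_explicit:
  assumes "norm (fst s) = 1" "norm (snd s) = 1"
    and ok: "(\<forall>t\<ge>1. r2rils_step_ok X (r2rils X s t)) \<or>
      (\<forall>t\<ge>1. explicit_step_ok X ((explicit_step X ^^ (t - 1)) s))"
  shows "r2rils X s t = (explicit_step X ^^ (t - 1)) s"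
    and "r2rils_step_ok X (r2rils X s t) \<longleftrightarrow> explicit_step_ok X ((explicit_step X ^^ (t - 1)) s)"
proof -
  have "r2rils_step_ok X ((r2rils_step X ^^ k) s)" if "\<forall>t\<ge>1. r2rils_step_ok X (r2rils X s t)" for k
    using that[rule_format, of "Suc k"] by (simp add: r2rils_def)
  moreover have "explicit_step_ok X ((explicit_step X ^^ k) s)"
    if "\<forall>t\<ge>1. explicit_step_ok X ((explicit_step X ^^ (t - 1)) s)" for k
    using that[rule_format, of "Suc k"] by simp
  ultimately have *: "(r2rils_step X ^^ n) s = (explicit_step X ^^ n) s \<and>
      norm (fst ((r2rils_step X ^^ n) s)) = 1 \<and> norm (snd ((r2rils_step X ^^ n) s)) = 1" for n
    using funpow_r2rils_step_explicit[OF assms(1,2)] ok by blast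
  show eq: "r2rils X s t = (explicit_step X ^^ (t - 1)) s"
    using * by (simp add: r2rils_def)
  show "r2rils_step_ok X (r2rils X s t) \<longleftrightarrow> explicit_step_ok X ((explicit_step X ^^ (t - 1)) s)"
    unfolding eq[symmetric] r2rils_def by (rule r2rils_step_explicit(2)) (use *[of "t - 1"] in blast)+
qed

lemma measurable_lsq_sol:
  fixes X :: "'a \<Rightarrow> real^'n^'m"
  assumes "X \<in> borel_measurable M" "s \<in> borel_measurable M"
  shows "(\<lambda>\<omega>. lsq_sol (X \<omega>) (s \<omega>)) \<in> borel_measurable M"
proof -
  have "continuous_on UNIV (\<lambda>r :: (real^'n^'m) \<times> ((real^'m) \<times> (real^'n)). lsq_sol (fst r) (snd r))"
    unfolding lsq_sol_def case_prod_unfold inner_vec_def matrix_vector_mult_def vector_matrix_mult_def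
    by (intro continuous_intros) simp_all
  then have c: "(\<lambda>r :: (real^'n^'m) \<times> ((real^'m) \<times> (real^'n)). lsq_sol (fst r) (snd r)) \<in> borel_measurable borel"
    by (rule borel_measurable_continuous_onI)
  have "(\<lambda>\<omega>. (X \<omega>, s \<omega>)) \<in> borel_measurable M"
    using assms by (rule borel_measurable_Pair)
  from measurable_compose[OF this c] show ?thesis by simp
qed

lemma measurable_col_norm [measurable]: "col_norm \<in> borel_measurable (borel :: 'a::euclidean_space measure)"
  unfolding col_norm_def by measurable

lemma measurable_fst_snd_borel:
  fixes s :: "'a \<Rightarrow> 'b::euclidean_space \<times> 'c::euclidean_space"
  assumes "s \<in> borel_measurable M"
  shows "(\<lambda>\<omega>. fst (s \<omega>)) \<in> borel_measurable M" and "(\<lambda>\<omega>. snd (s \<omega>)) \<in> borel_measurable M"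
  using assms by (simp_all add: borel_prod[symmetric])

lemma measurable_explicit_step:
  assumes "X \<in> borel_measurable M" "s \<in> borel_measurable M"
  shows "(\<lambda>\<omega>. explicit_step (X \<omega>) (s \<omega>)) \<in> borel_measurable M"
    and "Measurable.pred M (\<lambda>\<omega>. explicit_step_ok (X \<omega>) (s \<omega>))"
proof -
  note [measurable] = measurable_fst_snd_borel[OF assms(2)]
    measurable_fst_snd_borel[OF measurable_lsq_sol[OF assms]]
  show "(\<lambda>\<omega>. explicit_step (X \<omega>) (s \<omega>)) \<in> borel_measurable M"
    unfolding explicit_step_def by (intro borel_measurable_Pair) measurable
  show "Measurable.pred M (\<lambda>\<omega>. explicit_step_ok (X \<omega>) (s \<omega>))"
    unfolding explicit_step_ok_def by measurable
qed

lemma measurable_funpow_explicit_step: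
  assumes "X \<in> borel_measurable M" "s \<in> borel_measurable M"
  shows "(\<lambda>\<omega>. (explicit_step (X \<omega>) ^^ n) (s \<omega>)) \<in> borel_measurable M"
  by (induction n) (simp_all add: assms measurable_explicit_step)

section \<open>Measurability of the event and the final inclusion\<close>

theorem theorem3:
  fixes M :: "'a measure"
    and X Z :: "'a \<Rightarrow> real^'n^'m"
    and u :: "real^'m" and v :: "real^'n"
    and u\<^sub>1 :: "'a \<Rightarrow> real^'m" and v\<^sub>1 :: "'a \<Rightarrow> real^'n"
    and \<sigma> \<eta>\<^sub>0 \<eta> \<delta> R C :: real
  assumes "prob_space M"
    and "CARD('m) \<le> CARD('n)"
    and "\<sigma> > 0" and "\<eta>\<^sub>0 > 0"
    and "norm u = 1" and "norm v = 1"
    and "prob_space.indep_vars M (\<lambda>_. borel) (\<lambda>(i, j) \<omega>. Z \<omega> $ i $ j) (UNIV :: ('m \<times> 'n) set)"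
    and "\<And>i j. distributed M lborel (\<lambda>\<omega>. Z \<omega> $ i $ j) (normal_density 0 \<eta>\<^sub>0)"
    and "\<And>\<omega>. X \<omega> = \<sigma> *\<^sub>R outer_product u v + Z \<omega>"
    and "0 < \<delta>" and "\<delta> \<le> 1 / 4"
    and "u\<^sub>1 \<in> borel_measurable M" and "v\<^sub>1 \<in> borel_measurable M"
    and "\<And>\<omega>. \<omega> \<in> space M \<Longrightarrow> norm (u\<^sub>1 \<omega>) = 1"
    and "\<And>\<omega>. \<omega> \<in> space M \<Longrightarrow> norm (v\<^sub>1 \<omega>) = 1"
    and "\<And>\<omega>. \<omega> \<in> space M \<Longrightarrow> u \<bullet> u\<^sub>1 \<omega> \<ge> \<delta>"
    and "\<And>\<omega>. \<omega> \<in> space M \<Longrightarrow> v \<bullet> v\<^sub>1 \<omega> \<ge> \<delta>"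
    and "\<eta> = \<eta>\<^sub>0 * sqrt (real CARD('n))"
    and "R = sqrt (1 - 1 / sqrt 2)"
    and "C = 50 / (1 - R)"
    and "\<eta> / \<sigma> \<le> sqrt 2 / C * \<delta>"
  shows "\<P>(\<omega> in M.
      (\<forall>t\<ge>1. r2rils_step_ok (X \<omega>) (r2rils (X \<omega>) (u\<^sub>1 \<omega>, v\<^sub>1 \<omega>) t)) \<and>
      (\<forall>t\<ge>2. norm (r2rils (X \<omega>) (u\<^sub>1 \<omega>, v\<^sub>1 \<omega>) t - (u, v))
               \<le> sqrt 3 * R ^ (t - 2) + 4 * C * (1 - R ^ (t - 2)) * (\<eta> / \<sigma>)) \<and>
      (\<forall>t. real t \<ge> 3 * ln (\<sigma> / \<eta>) \<longrightarrow>
               norm (r2rils (X \<omega>) (u\<^sub>1 \<omega>, v\<^sub>1 \<omega>) t - (u, v)) \<le> 500 * (\<eta> / \<sigma>)))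
    \<ge> 1 - exp (- (real CARD('n) / 2))"
proof -
  interpret prob_space M by fact
  note card = assms(2) and \<sigma> = assms(3) and \<eta>0 = assms(4) and u = assms(5) and v = assms(6)
    and indep = assms(7) and gauss = assms(8) and X = assms(9) and \<delta> = assms(10,11)
    and start_meas = assms(12,13) and unit = assms(14,15) and corr = assms(16,17)
    and \<eta>_eq = assms(18) and R = assms(19) and C = assms(20) and ratio = assms(21)
  have \<eta>: "0 < \<eta>" using \<eta>0 by (simp add: \<eta>_eq)
  have x: "0 < \<eta> / \<sigma>" "\<eta> / \<sigma> \<le> 1 / 100"
  proof -
    show "0 < \<eta> / \<sigma>" using \<eta> \<sigma> by simp
    have "100 \<le> C" using rate_bounds R by (simp add: C field_simps)
    then have "sqrt 2 / C * \<delta> \<le> 2 / 100 * (1 / 4)"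
      using \<delta> sqrt2_less_2 by (intro mult_mono frac_le) auto
    then show "\<eta> / \<sigma> \<le> 1 / 100" using ratio by linarith
  qed
  define good where "good r \<longleftrightarrow> (\<forall>t\<ge>2. norm (r t - (u, v))
               \<le> sqrt 3 * R ^ (t - 2) + 4 * C * (1 - R ^ (t - 2)) * (\<eta> / \<sigma>)) \<and>
      (\<forall>t. real t \<ge> 3 * ln (\<sigma> / \<eta>) \<longrightarrow> norm (r t - (u, v)) \<le> 500 * (\<eta> / \<sigma>))"
    for r :: "nat \<Rightarrow> (real^'m) \<times> (real^'n)"
  define S where "S = {\<omega> \<in> space M. (\<forall>t\<ge>1. r2rils_step_ok (X \<omega>) (r2rils (X \<omega>) (u\<^sub>1 \<omega>, v\<^sub>1 \<omega>) t)) \<and>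
      good (r2rils (X \<omega>) (u\<^sub>1 \<omega>, v\<^sub>1 \<omega>))}"
  define w where "w \<omega> t = (explicit_step (X \<omega>) ^^ (t - 1)) (u\<^sub>1 \<omega>, v\<^sub>1 \<omega>)" for \<omega> t
  \<comment> \<open>Measurability of \<open>S\<close> is obtained by rewriting it in terms of the
    explicit iterates, since those of \<open>r2rils_step\<close> involve a choice of
    minimizer.\<close>
  have "S = {\<omega> \<in> space M. (\<forall>t\<ge>1. explicit_step_ok (X \<omega>) (w \<omega> t)) \<and> good (w \<omega>)}"
  proof -
    have "(\<forall>t\<ge>1. r2rils_step_ok (X \<omega>) (r2rils (X \<omega>) (u\<^sub>1 \<omega>, v\<^sub>1 \<omega>) t)) \<and>
        good (r2rils (X \<omega>) (u\<^sub>1 \<omega>, v\<^sub>1 \<omega>)) \<longleftrightarrow>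
        (\<forall>t\<ge>1. explicit_step_ok (X \<omega>) (w \<omega> t)) \<and> good (w \<omega>)" (is "?A \<and> _ \<longleftrightarrow> ?B \<and> _")
      if "\<omega> \<in> space M" for \<omega>
    proof -
      \<comment> \<open>If neither \<open>?A\<close> nor \<open>?B\<close> holds, both sides of the
        equivalence are false, so the sequences need to agree only when one of them holds.\<close>
      have "r2rils (X \<omega>) (u\<^sub>1 \<omega>, v\<^sub>1 \<omega>) = w \<omega> \<and> (?A \<longleftrightarrow> ?B)" if AB: "?A \<or> ?B"
      proof -
        have "norm (fst (u\<^sub>1 \<omega>, v\<^sub>1 \<omega>)) = 1" "norm (snd (u\<^sub>1 \<omega>, v\<^sub>1 \<omega>)) = 1"
          using unit[OF \<open>\<omega> \<in> space M\<close>] by simp_all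
        note ex = r2rils_explicit[OF this AB[unfolded w_def]]
        have "r2rils (X \<omega>) (u\<^sub>1 \<omega>, v\<^sub>1 \<omega>) = w \<omega>"
          by (rule ext) (simp only: w_def ex(1))
        moreover have "?A \<longleftrightarrow> ?B"
          by (simp only: w_def ex(2))
        ultimately show ?thesis by blast
      qed
      then show ?thesis by metis
    qed
    then show ?thesis unfolding S_def by blast
  qed
  also have "\<dots> \<in> sets M"
  proof -
    have [measurable]: "Z \<in> borel_measurable M"
      by (rule gaussian_matrix_measurable[OF indep gauss \<eta>0])
    have "X = (\<lambda>\<omega>. \<sigma> *\<^sub>R outer_product u v + Z \<omega>)"
      by (rule ext) (rule X)
    then have Xm: "X \<in> borel_measurable M"
      by simp
    have w0: "(\<lambda>\<omega>. (u\<^sub>1 \<omega>, v\<^sub>1 \<omega>)) \<in> borel_measurable M"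
      using start_meas by (rule borel_measurable_Pair)
    have [measurable]: "(\<lambda>\<omega>. w \<omega> t) \<in> borel_measurable M" for t
      unfolding w_def by (rule measurable_funpow_explicit_step[OF Xm w0])
    have [measurable]: "Measurable.pred M (\<lambda>\<omega>. explicit_step_ok (X \<omega>) (w \<omega> t))" for t
      by (rule measurable_explicit_step(2)[OF Xm]) measurable
    show ?thesis unfolding good_def by measurable
  qed
  finally have S: "S \<in> sets M" .
  obtain E where E: "E \<in> sets M" "prob E \<ge> 1 - exp (- (real CARD('n) / 2))"
      "\<And>\<omega>. \<omega> \<in> E \<Longrightarrow> onorm ((*v) (Z \<omega>)) \<le> 11 / 2 * \<eta>"
    using gaussian_matrix_onorm_bound[OF indep gauss \<eta>0 card] unfolding \<eta>_eq by blast
  have "E \<subseteq> S"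
  proof
    fix \<omega> assume "\<omega> \<in> E"
    then have \<omega>: "\<omega> \<in> space M" using sets.sets_into_space[OF E(1)] by blast
    have Zle: "norm (Z \<omega> *v z) \<le> (11 / 2 * \<eta>) * norm z" for z
    proof -
      have "norm (Z \<omega> *v z) \<le> onorm ((*v) (Z \<omega>)) * norm z"
        by (rule onorm) simp
      also have "\<dots> \<le> (11 / 2 * \<eta>) * norm z"
        using E(3)[OF \<open>\<omega> \<in> E\<close>] by (rule mult_right_mono) simp
      finally show ?thesis .
    qed
    note err = r2rils_error[OF u v unit(1)[OF \<omega>] unit(2)[OF \<omega>] X \<sigma> Zle \<eta> \<delta> corr(1)[OF \<omega>] corr(2)[OF \<omega>] R C ratio]
    \<comment> \<open>The logarithmic lower bound already forces \<open>t\<close> to be at least 2,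
      where the geometric bound is available.\<close>
    have "norm (r2rils (X \<omega>) (u\<^sub>1 \<omega>, v\<^sub>1 \<omega>) t - (u, v)) \<le> 500 * (\<eta> / \<sigma>)"
      if "real t \<ge> 3 * ln (\<sigma> / \<eta>)" for t
      using geometric_bound_after_log[OF R C x, of t] that err(2) by force
    then show "\<omega> \<in> S"
      using \<omega> err by (simp add: S_def good_def)
  qed
  then have "prob E \<le> prob S" using S by (rule finite_measure_mono)
  then have "1 - exp (- (real CARD('n) / 2)) \<le> prob S" using E(2) by linarith
  then show ?thesis unfolding S_def good_def .
qed

end
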